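(* The Kuramoto–Sivashinsky equation $h_t=\nu\nabla^2h-\kappa\nabla^4h+\lambda|\nabla h|^2$ does not admit supplementary symmetries of nonclassical type: the nonclassical symmetry method applied to this equation generates only the classical Lie symmetry operators, i.e. the only solutions of the determining equations of its nonclassical symmetries are exactly those obtained by the classical symmetry approach.
   Context: Here $h=h(x,y,t)$, the prefactors $\nu,\kappa,\lambda$ are constants, and $\nabla=(\partial_x,\partial_y)$, so $\nabla^2h=h_{xx}+h_{yy}$, $\nabla^4h=h_{xxxx}+2h_{xxyy}+h_{yyyy}$ and $|\nabla h|^2=h_x^2+h_y^2$. Put $\Delta_1:=h_t-\nu\nabla^2h+\kappa\nabla^4h-\lambda|\nabla h|^2$ and, for a vector field $V=\xi^1\partial_x+\xi^2\partial_y+\xi^3\partial_t+\varphi\,\partial_h$ with coefficients functions of $(x,y,t,h)$, let $\Delta_2:=\varphi-\xi^1h_x-\xi^2h_y-\xi^3h_t$, so that $\Delta_2=0$ is the invariant surface condition. Let $V^{(4)}$ be the fourth prolongation of $V$. The field $V$ is a classical Lie symmetry operator if $V^{(4)}\Delta_1=0$ whenever $\Delta_1=0$. It is a nonclassical symmetry if $V^{(4)}\Delta_1=0$ whenever $\Delta_1=0$ and $\Delta_2=0$ (the latter taken together with its differential consequences); the determining equations of the nonclassical symmetries are the equations on $\xi^1,\xi^2,\xi^3,\varphi$ expressing this condition.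
   Formalization: Proved for κ, λ ≠ 0 and fields with ξ³ nowhere zero (for ξ³ = 0 the claim fails: ∂_x + b(x)∂_h, κb''''−νb''=2λbb', b''≠0): nonclassical symmetries are exactly the classical ones up to a nonvanishing function factor; literal coincidence is proved for ξ³ = 1 and ν ≠ 0. *)

theory Defs
  imports "HOL-Analysis.Analysis"
begin

text \<open>Points of the space of independent and dependent variables are tuples (x, y, t, h).\<close>

type_synonym pt = "real \<times> real \<times> real \<times> real"

fun Ck_on :: "nat \<Rightarrow> 'a::real_normed_vector set \<Rightarrow> ('a \<Rightarrow> 'b::real_normed_vector) \<Rightarrow> bool" where
  "Ck_on 0 S f \<longleftrightarrow> continuous_on S f"
| "Ck_on (Suc n) S f \<longleftrightarrow> (\<forall>x\<in>S. f differentiable (at x)) \<and>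
     (\<forall>v. Ck_on n S (\<lambda>x. frechet_derivative f (at x) v))"

definition smooth_on :: "'a::real_normed_vector set \<Rightarrow> ('a \<Rightarrow> 'b::real_normed_vector) \<Rightarrow> bool" where
  "smooth_on S f \<longleftrightarrow> (\<forall>n. Ck_on n S f)"


subsection \<open>Jet space and total derivatives\<close>

datatype indep = Vx | Vy | Vt

text \<open>The multi-index (a, b, c) stands for a derivatives in x, b in y and c in t. The coordinate
  \<open>Dep (a, b, c)\<close> of the infinite jet space is the corresponding derivative of h;
  in particular \<open>Dep (0, 0, 0)\<close> is h itself.\<close>

type_synonym multi = "nat \<times> nat \<times> nat"

datatype coord = Base indep | Dep multi

type_synonym jet = "coord \<Rightarrow> real"

fun mi_order :: "multi \<Rightarrow> nat" where
  "mi_order (a, b, c) = a + b + c"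

fun mi_up :: "indep \<Rightarrow> multi \<Rightarrow> multi" where
  "mi_up Vx (a, b, c) = (Suc a, b, c)"
| "mi_up Vy (a, b, c) = (a, Suc b, c)"
| "mi_up Vt (a, b, c) = (a, b, Suc c)"

definition jet_pt :: "jet \<Rightarrow> pt" where
  "jet_pt z = (z (Base Vx), z (Base Vy), z (Base Vt), z (Dep (0, 0, 0)))"

definition partial_deriv :: "coord \<Rightarrow> (jet \<Rightarrow> real) \<Rightarrow> jet \<Rightarrow> real" where
  "partial_deriv c F z = deriv (\<lambda>s. F (z(c := s))) (z c)"

text \<open>The index set of the sum is finite for every F that depends on finitely many jet coordinates
  near z, so that the convention for infinite sums plays no role for such F.\<close>

definition total_deriv :: "indep \<Rightarrow> (jet \<Rightarrow> real) \<Rightarrow> jet \<Rightarrow> real" where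
  "total_deriv i F z = partial_deriv (Base i) F z +
     (\<Sum>J\<in>{J. partial_deriv (Dep J) F z \<noteq> 0}. z (Dep (mi_up i J)) * partial_deriv (Dep J) F z)"

fun total_deriv_multi :: "multi \<Rightarrow> (jet \<Rightarrow> real) \<Rightarrow> jet \<Rightarrow> real" where
  "total_deriv_multi (a, b, c) F = (total_deriv Vx ^^ a) ((total_deriv Vy ^^ b) ((total_deriv Vt ^^ c) F))"


subsection \<open>Vector fields and their prolongations\<close>

record vfield =
  xi1 :: "pt \<Rightarrow> real"
  xi2 :: "pt \<Rightarrow> real"
  xi3 :: "pt \<Rightarrow> real"
  phi :: "pt \<Rightarrow> real"

definition smooth_vfield :: "pt set \<Rightarrow> vfield \<Rightarrow> bool" where
  "smooth_vfield \<Omega> V \<longleftrightarrow>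
     smooth_on \<Omega> (xi1 V) \<and> smooth_on \<Omega> (xi2 V) \<and> smooth_on \<Omega> (xi3 V) \<and> smooth_on \<Omega> (phi V)"

definition multiple_on :: "pt set \<Rightarrow> (pt \<Rightarrow> real) \<Rightarrow> vfield \<Rightarrow> vfield \<Rightarrow> bool" where
  "multiple_on \<Omega> f W V \<longleftrightarrow> (\<forall>p\<in>\<Omega>.
     xi1 V p = f p * xi1 W p \<and> xi2 V p = f p * xi2 W p \<and>
     xi3 V p = f p * xi3 W p \<and> phi V p = f p * phi W p)"

definition Delta2 :: "vfield \<Rightarrow> jet \<Rightarrow> real" where
  "Delta2 V z = phi V (jet_pt z) - xi1 V (jet_pt z) * z (Dep (1, 0, 0))
     - xi2 V (jet_pt z) * z (Dep (0, 1, 0)) - xi3 V (jet_pt z) * z (Dep (0, 0, 1))"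

text \<open>The general prolongation formula: the coefficient of \<open>\<partial>/\<partial>h\<^sub>J\<close> is
  \<open>D\<^sub>J (\<phi> - \<Sum>\<^sub>i \<xi>\<^sup>i h\<^sub>i) + \<Sum>\<^sub>i \<xi>\<^sup>i h\<^sub>J\<^sub>,\<^sub>i\<close>.\<close>

definition prolong_coeff :: "vfield \<Rightarrow> multi \<Rightarrow> jet \<Rightarrow> real" where
  "prolong_coeff V J z = total_deriv_multi J (Delta2 V) z
     + xi1 V (jet_pt z) * z (Dep (mi_up Vx J))
     + xi2 V (jet_pt z) * z (Dep (mi_up Vy J))
     + xi3 V (jet_pt z) * z (Dep (mi_up Vt J))"

definition prolong :: "nat \<Rightarrow> vfield \<Rightarrow> (jet \<Rightarrow> real) \<Rightarrow> jet \<Rightarrow> real" where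
  "prolong n V F z = xi1 V (jet_pt z) * partial_deriv (Base Vx) F z
     + xi2 V (jet_pt z) * partial_deriv (Base Vy) F z
     + xi3 V (jet_pt z) * partial_deriv (Base Vt) F z
     + (\<Sum>J\<in>{J. mi_order J \<le> n}. prolong_coeff V J z * partial_deriv (Dep J) F z)"


subsection \<open>The Kuramoto--Sivashinsky equation and its symmetries\<close>

definition Delta1 :: "real \<Rightarrow> real \<Rightarrow> real \<Rightarrow> jet \<Rightarrow> real" where
  "Delta1 nu kappa lam z = z (Dep (0, 0, 1))
     - nu * (z (Dep (2, 0, 0)) + z (Dep (0, 2, 0)))
     + kappa * (z (Dep (4, 0, 0)) + 2 * z (Dep (2, 2, 0)) + z (Dep (0, 4, 0)))
     - lam * ((z (Dep (1, 0, 0)))\<^sup>2 + (z (Dep (0, 1, 0)))\<^sup>2)"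

definition classical_symmetry :: "real \<Rightarrow> real \<Rightarrow> real \<Rightarrow> pt set \<Rightarrow> vfield \<Rightarrow> bool" where
  "classical_symmetry nu kappa lam \<Omega> V \<longleftrightarrow> smooth_vfield \<Omega> V \<and>
     (\<forall>z. jet_pt z \<in> \<Omega> \<and> Delta1 nu kappa lam z = 0 \<longrightarrow>
        prolong 4 V (Delta1 nu kappa lam) z = 0)"

text \<open>Only the differential consequences of \<open>Delta2 V = 0\<close> are imposed. Imposing those of
  \<open>Delta1 = 0\<close> as well would make the condition hold for every V.\<close>

definition nonclassical_symmetry :: "real \<Rightarrow> real \<Rightarrow> real \<Rightarrow> pt set \<Rightarrow> vfield \<Rightarrow> bool" where
  "nonclassical_symmetry nu kappa lam \<Omega> V \<longleftrightarrow> smooth_vfield \<Omega> V \<and>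
     (\<forall>z. jet_pt z \<in> \<Omega> \<and> Delta1 nu kappa lam z = 0 \<and>
          (\<forall>J. total_deriv_multi J (Delta2 V) z = 0) \<longrightarrow>
        prolong 4 V (Delta1 nu kappa lam) z = 0)"

end

theory Submission
  imports Defs
begin

text \<open>
  Dividing by \<open>\<xi>\<^sup>3\<close> changes neither the invariant surface nor, on it, the vanishing of the prolonged
  action (\<open>nonclassical_symmetry_multiple\<close>), so V may be normalized to \<open>\<xi>\<^sup>3 = 1\<close>. The invariant surface
  condition then is the evolution equation \<open>h\<^sub>t = \<phi> - \<xi>\<^sup>1 h\<^sub>x - \<xi>\<^sup>2 h\<^sub>y\<close>, which has a formal solution for
  every choice of the derivatives of h in x and y (\<open>exists_jet_on_invariant_surface\<close>). The only
  remaining constraint is \<open>Delta1 = 0\<close>, solved for one fourth derivative of h, so the coefficients of the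
  other jet coordinates in \<open>V\<^sup>(\<^sup>4\<^sup>) Delta1\<close> must vanish separately. The quadratic terms
  \<open>h\<^sub>x\<^sub>x h\<^sub>x\<^sub>x\<^sub>x\<close> and \<open>h\<^sub>x\<^sub>x\<^sup>2\<close> show that \<open>\<xi>\<^sup>1\<close>, \<open>\<xi>\<^sup>2\<close> do not depend on h and that \<open>\<phi>\<close> is affine in h
  (\<open>nonclassical_h_dependence\<close>). The fourth order terms are the Cauchy-Riemann equations for
  \<open>(\<xi>\<^sup>1, \<xi>\<^sup>2)\<close>, the terms \<open>h\<^sub>x\<^sup>2\<close> give \<open>\<phi>\<^sub>h = -2a\<close> with \<open>a = \<xi>\<^sup>1\<^sub>x\<close>, the third order terms make a
  depend on t alone, and the second order terms give \<open>\<nu>a = 0\<close> (\<open>nonclassical_coefficients\<close>).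

  What is left differs from the classical determining equations only by terms with a factor a, and
  the integrability conditions force the Riccati equation \<open>a\<^sub>t = -4a\<^sup>2\<close> (\<open>nonclassical_equations\<close>). Its
  solutions near a point vanish identically or nowhere, so the zero set of a is open and closed in the
  domain. If a = 0 the equations are the classical ones; otherwise \<open>a = 1 / (4t + c)\<close> and V / a is
  a classical symmetry, a scaling with \<open>\<xi>\<^sup>3 = 4t + c\<close> up to symmetries with \<open>\<xi>\<^sup>3 = 0\<close>; the equation has such
  scalings only for \<open>\<nu> = 0\<close>. The function f that is 1 or a accordingly is the required factor
  (\<open>riccati_integrating_factor\<close>), and \<open>\<nu> \<noteq> 0\<close> leaves only f = 1.
\<close>

section \<open>Smooth functions and their partial derivatives\<close>

definition dir :: "'a::real_normed_vector \<Rightarrow> ('a \<Rightarrow> real) \<Rightarrow> 'a \<Rightarrow> real" where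
  "dir v g p = frechet_derivative g (at p) v"

lemma dir_eqI: "(g has_derivative D) (at p) \<Longrightarrow> dir v g p = D v"
  unfolding dir_def by (metis frechet_derivative_at)

lemma smooth_on_differentiable: "smooth_on S g \<Longrightarrow> p \<in> S \<Longrightarrow> g differentiable (at p)"
  unfolding smooth_on_def by (metis Ck_on.simps(2))

lemma smooth_on_has_derivative:
  "smooth_on S g \<Longrightarrow> p \<in> S \<Longrightarrow> (g has_derivative (\<lambda>v. dir v g p)) (at p)"
  unfolding dir_def using smooth_on_differentiable frechet_derivative_works by blast

lemma smooth_on_dir: "smooth_on S g \<Longrightarrow> smooth_on S (dir v g)"
  unfolding smooth_on_def dir_def[abs_def] by (metis Ck_on.simps(2))

lemma smooth_on_continuous: "smooth_on S g \<Longrightarrow> continuous_on S g"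
  unfolding smooth_on_def by (metis Ck_on.simps(1))

lemma frechet_derivative_cong_open:
  assumes "open S" "p \<in> S" "\<And>q. q \<in> S \<Longrightarrow> f q = g q"
  shows "frechet_derivative f (at p) = frechet_derivative g (at p)"
proof -
  have "(f has_derivative D) (at p) \<longleftrightarrow> (g has_derivative D) (at p)" for D
    using has_derivative_transform_within_open[of f D p UNIV S g]
      has_derivative_transform_within_open[of g D p UNIV S f] assms by auto
  then show ?thesis unfolding frechet_derivative_def by simp
qed

lemma dir_cong:
  assumes "open S" "p \<in> S" "\<And>q. q \<in> S \<Longrightarrow> f q = g q"
  shows "dir v f p = dir v g p"
  unfolding dir_def using frechet_derivative_cong_open[OF assms] by simp

lemma Ck_on_cong:
  assumes "open S" "\<And>q. q \<in> S \<Longrightarrow> f q = g q" "Ck_on n S f"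
  shows "Ck_on n S g"
  using assms(2,3)
proof (induction n arbitrary: f g)
  case 0
  then show ?case using continuous_on_cong by force
next
  case (Suc n)
  have "g differentiable (at x)" if "x \<in> S" for x
  proof -
    obtain D where "(f has_derivative D) (at x)"
      using Suc.prems(2) \<open>x \<in> S\<close> by (auto simp: differentiable_def)
    then have "(g has_derivative D) (at x)"
      by (rule has_derivative_transform_within_open[OF _ assms(1) that Suc.prems(1)])
    then show ?thesis by (auto simp: differentiable_def)
  qed
  moreover have "Ck_on n S (\<lambda>x. frechet_derivative g (at x) v)" for v
    using Suc.IH[of "\<lambda>x. frechet_derivative f (at x) v" "\<lambda>x. frechet_derivative g (at x) v"]
      Suc.prems frechet_derivative_cong_open[OF assms(1), of _ f g] by auto
  ultimately show ?case by simp
qed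

lemma smooth_on_cong:
  "open S \<Longrightarrow> (\<And>q. q \<in> S \<Longrightarrow> f q = g q) \<Longrightarrow> smooth_on S f \<Longrightarrow> smooth_on S g"
  unfolding smooth_on_def using Ck_on_cong by blast

lemma Ck_on_Un:
  assumes "open S" "open T"
  shows "Ck_on n S f \<Longrightarrow> Ck_on n T f \<Longrightarrow> Ck_on n (S \<union> T) f"
  by (induction n arbitrary: f) (use assms continuous_on_open_Un in auto)

lemma smooth_on_Un:
  "open S \<Longrightarrow> open T \<Longrightarrow> smooth_on S f \<Longrightarrow> smooth_on T f \<Longrightarrow> smooth_on (S \<union> T) f"
  unfolding smooth_on_def using Ck_on_Un by blast

lemma smooth_on_subset: "T \<subseteq> S \<Longrightarrow> smooth_on S f \<Longrightarrow> smooth_on T f"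
proof -
  have "Ck_on n S f \<Longrightarrow> Ck_on n T f" if "T \<subseteq> S" for n and f :: "'a \<Rightarrow> 'b"
    by (induction n arbitrary: f) (use that continuous_on_subset in auto)
  then show "T \<subseteq> S \<Longrightarrow> smooth_on S f \<Longrightarrow> smooth_on T f" unfolding smooth_on_def by blast
qed

lemma Ck_on_const: "Ck_on n S (\<lambda>_. c)"
  by (induction n arbitrary: c) auto

lemma smooth_on_const: "smooth_on S (\<lambda>_. c)"
  unfolding smooth_on_def using Ck_on_const by blast

lemma Ck_on_lower: "Ck_on (Suc n) S f \<Longrightarrow> Ck_on n S f"
proof (induction n arbitrary: f)
  case 0
  then show ?case
    by (auto intro!: continuous_at_imp_continuous_on differentiable_imp_continuous_within)
next
  case (Suc n)
  then show ?case by (metis Ck_on.simps(2))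
qed

lemma Ck_on_add:
  assumes "open S"
  shows "Ck_on n S f \<Longrightarrow> Ck_on n S g \<Longrightarrow> Ck_on n S (\<lambda>x. f x + g x)"
proof (induction n arbitrary: f g)
  case 0
  then show ?case by (simp add: continuous_on_add)
next
  case (Suc n)
  have "Ck_on n S (\<lambda>x. frechet_derivative (\<lambda>x. f x + g x) (at x) v)" for v
  proof (rule Ck_on_cong[OF assms])
    show "Ck_on n S (\<lambda>x. frechet_derivative f (at x) v + frechet_derivative g (at x) v)"
      using Suc by simp
    fix q assume "q \<in> S"
    then have "((\<lambda>x. f x + g x) has_derivative
        (\<lambda>v. frechet_derivative f (at q) v + frechet_derivative g (at q) v)) (at q)"
      using Suc.prems by (intro has_derivative_add) (auto simp: frechet_derivative_works)
    from frechet_derivative_at[OF this, symmetric]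
    show "frechet_derivative f (at q) v + frechet_derivative g (at q) v =
        frechet_derivative (\<lambda>x. f x + g x) (at q) v" by simp
  qed
  then show ?case using Suc.prems by auto
qed

lemma Ck_on_mult:
  fixes f g :: "'a::real_normed_vector \<Rightarrow> real"
  assumes "open S"
  shows "Ck_on n S f \<Longrightarrow> Ck_on n S g \<Longrightarrow> Ck_on n S (\<lambda>x. f x * g x)"
proof (induction n arbitrary: f g)
  case 0
  then show ?case by (simp add: continuous_on_mult)
next
  case (Suc n)
  have "Ck_on n S (\<lambda>x. frechet_derivative (\<lambda>x. f x * g x) (at x) v)" for v
  proof (rule Ck_on_cong[OF assms])
    show "Ck_on n S (\<lambda>x. f x * frechet_derivative g (at x) v + frechet_derivative f (at x) v * g x)"
      by (intro Ck_on_add[OF assms] Suc.IH) (use Suc.prems Ck_on_lower in auto)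
    fix q assume "q \<in> S"
    then have D: "((\<lambda>x. f x * g x) has_derivative
        (\<lambda>v. f q * frechet_derivative g (at q) v + frechet_derivative f (at q) v * g q)) (at q)"
      using Suc.prems by (intro has_derivative_mult) (auto simp: frechet_derivative_works)
    show "f q * frechet_derivative g (at q) v + frechet_derivative f (at q) v * g q =
        frechet_derivative (\<lambda>x. f x * g x) (at q) v"
      using frechet_derivative_at[OF D, symmetric] by simp
  qed
  then show ?case using Suc.prems by (auto intro: differentiable_mult)
qed

lemma Ck_on_inverse:
  fixes f :: "'a::real_normed_vector \<Rightarrow> real"
  assumes "open S" "\<And>x. x \<in> S \<Longrightarrow> f x \<noteq> 0"
  shows "Ck_on n S f \<Longrightarrow> Ck_on n S (\<lambda>x. inverse (f x))"
proof (induction n)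
  case 0
  then show ?case using assms by (simp add: continuous_on_inverse)
next
  case (Suc n)
  have I: "Ck_on n S (\<lambda>x. inverse (f x))" using Suc Ck_on_lower by blast
  have D: "((\<lambda>x. inverse (f x)) has_derivative
        (\<lambda>v. (-1) * (inverse (f q) * frechet_derivative f (at q) v * inverse (f q)))) (at q)"
    if "q \<in> S" for q
    using Suc.prems Deriv.has_derivative_inverse[of f q "frechet_derivative f (at q)" UNIV]
      assms(2)[OF that] that by (auto simp: frechet_derivative_works)
  have "Ck_on n S (\<lambda>x. frechet_derivative (\<lambda>x. inverse (f x)) (at x) v)" for v
  proof (rule Ck_on_cong[OF assms(1)])
    show "Ck_on n S (\<lambda>q. (-1) * (inverse (f q) * frechet_derivative f (at q) v * inverse (f q)))"
      by (intro Ck_on_mult[OF assms(1)] Ck_on_const I) (use Suc.prems in auto)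
    fix q assume "q \<in> S"
    then show "(-1) * (inverse (f q) * frechet_derivative f (at q) v * inverse (f q)) =
        frechet_derivative (\<lambda>x. inverse (f x)) (at q) v"
      using frechet_derivative_at[OF D, symmetric] by simp
  qed
  then show ?case using D by (auto simp: differentiable_def)
qed

lemma smooth_on_mult:
  fixes f g :: "'a::real_normed_vector \<Rightarrow> real"
  shows "open S \<Longrightarrow> smooth_on S f \<Longrightarrow> smooth_on S g \<Longrightarrow> smooth_on S (\<lambda>x. f x * g x)"
  unfolding smooth_on_def using Ck_on_mult by blast

lemma smooth_on_divide:
  fixes f g :: "'a::real_normed_vector \<Rightarrow> real"
  assumes "open S" "smooth_on S f" "smooth_on S g" "\<And>x. x \<in> S \<Longrightarrow> g x \<noteq> 0"
  shows "smooth_on S (\<lambda>x. f x / g x)"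
  using assms Ck_on_mult Ck_on_inverse unfolding smooth_on_def divide_inverse by blast

lemma dir_const [simp]: "dir v (\<lambda>_. c) p = 0"
  by (simp add: dir_def)

lemma dir_cmult:
  assumes "smooth_on S g" "p \<in> S"
  shows "dir v (\<lambda>q. c * g q) p = c * dir v g p"
  by (rule dir_eqI[where D="\<lambda>v. c * dir v g p"])
     (intro has_derivative_mult_right smooth_on_has_derivative[OF assms])

lemma dir_divide:
  assumes "smooth_on S f" "smooth_on S g" "p \<in> S" "g p \<noteq> 0"
  shows "dir v (\<lambda>q. f q / g q) p = (dir v f p * g p - f p * dir v g p) / (g p * g p)"
  by (rule dir_eqI[where D="\<lambda>v. (dir v f p * g p - f p * dir v g p) / (g p * g p)"])
     (intro has_derivative_divide' smooth_on_has_derivative[OF assms(1,3)] smooth_on_has_derivative[OF assms(2,3)] assms)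

lemma smooth_line_derivative:
  assumes "smooth_on S g" "p + s *\<^sub>R u \<in> S"
  shows "((\<lambda>s. g (p + s *\<^sub>R u)) has_real_derivative dir u g (p + s *\<^sub>R u)) (at s)"
proof -
  have lin: "linear (\<lambda>v. dir v g (p + s *\<^sub>R u))"
    using smooth_on_has_derivative[OF assms] has_derivative_linear by blast
  have "((\<lambda>s. p + s *\<^sub>R u) has_derivative (\<lambda>h. h *\<^sub>R u)) (at s)"
    by (auto intro!: derivative_eq_intros)
  from has_derivative_compose[OF this, of g "\<lambda>v. dir v g (p + s *\<^sub>R u)"]
  have "((\<lambda>s. g (p + s *\<^sub>R u)) has_derivative (\<lambda>h. dir (h *\<^sub>R u) g (p + s *\<^sub>R u))) (at s)"
    using smooth_on_has_derivative[OF assms] by simp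
  moreover have "(\<lambda>h. dir (h *\<^sub>R u) g (p + s *\<^sub>R u)) = (*) (dir u g (p + s *\<^sub>R u))"
    using linear_scale[OF lin] by (auto simp: mult.commute)
  ultimately show ?thesis by (simp add: has_field_derivative_def)
qed

text \<open>Both iterated derivatives are limits of the same second difference quotient; two applications
  of the mean value theorem express that quotient through a value of either of them nearby.\<close>

lemma second_difference:
  assumes "smooth_on S g" "0 < e"
    and box: "\<And>s t. 0 \<le> s \<Longrightarrow> s \<le> e \<Longrightarrow> 0 \<le> t \<Longrightarrow> t \<le> e \<Longrightarrow> p + s *\<^sub>R u + t *\<^sub>R v \<in> S"
  shows "\<exists>s t. 0 \<le> s \<and> s \<le> e \<and> 0 \<le> t \<and> t \<le> e \<and>
    g (p + e *\<^sub>R u + e *\<^sub>R v) - g (p + e *\<^sub>R u) - g (p + e *\<^sub>R v) + g p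
      = e * e * dir v (dir u g) (p + s *\<^sub>R u + t *\<^sub>R v)"
proof -
  have "\<exists>s. 0 < s \<and> s < e \<and>
      (g (p + e *\<^sub>R v + e *\<^sub>R u) - g (p + e *\<^sub>R u)) - (g (p + e *\<^sub>R v + 0 *\<^sub>R u) - g (p + 0 *\<^sub>R u))
      = (e - 0) * (dir u g (p + e *\<^sub>R v + s *\<^sub>R u) - dir u g (p + s *\<^sub>R u))"
  proof (rule MVT2[of 0 e "\<lambda>s. g (p + e *\<^sub>R v + s *\<^sub>R u) - g (p + s *\<^sub>R u)"])
    fix s assume s: "0 \<le> s" "s \<le> e"
    have "p + e *\<^sub>R v + s *\<^sub>R u \<in> S" "p + s *\<^sub>R u \<in> S"
      using box[OF s, of e] box[OF s, of 0] assms(2) by (auto simp: algebra_simps)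
    then show "((\<lambda>s. g (p + e *\<^sub>R v + s *\<^sub>R u) - g (p + s *\<^sub>R u)) has_real_derivative
        dir u g (p + e *\<^sub>R v + s *\<^sub>R u) - dir u g (p + s *\<^sub>R u)) (at s)"
      using smooth_line_derivative[OF assms(1)] by (intro DERIV_diff) auto
  qed (use assms in auto)
  then obtain s where s: "0 < s" "s < e"
    "g (p + e *\<^sub>R v + e *\<^sub>R u) - g (p + e *\<^sub>R u) - (g (p + e *\<^sub>R v) - g p)
      = e * (dir u g (p + e *\<^sub>R v + s *\<^sub>R u) - dir u g (p + s *\<^sub>R u))" by auto
  have "\<exists>t. 0 < t \<and> t < e \<and> dir u g (p + s *\<^sub>R u + e *\<^sub>R v) - dir u g (p + s *\<^sub>R u + 0 *\<^sub>R v)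
      = (e - 0) * dir v (dir u g) (p + s *\<^sub>R u + t *\<^sub>R v)"
  proof (rule MVT2[of 0 e "\<lambda>t. dir u g (p + s *\<^sub>R u + t *\<^sub>R v)"])
    fix t assume "0 \<le> t" "t \<le> e"
    then show "((\<lambda>t. dir u g (p + s *\<^sub>R u + t *\<^sub>R v)) has_real_derivative
        dir v (dir u g) (p + s *\<^sub>R u + t *\<^sub>R v)) (at t)"
      using box s by (intro smooth_line_derivative[OF smooth_on_dir[OF assms(1)]]) auto
  qed (use assms in auto)
  then obtain t where t: "0 < t" "t < e"
    "dir u g (p + s *\<^sub>R u + e *\<^sub>R v) - dir u g (p + s *\<^sub>R u)
      = e * dir v (dir u g) (p + s *\<^sub>R u + t *\<^sub>R v)" by auto
  show ?thesis
    using s t by (intro exI[of _ s] exI[of _ t]) (auto simp: algebra_simps)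
qed

lemma dir_commute:
  assumes "smooth_on S g" "open S" "p \<in> S"
  shows "dir u (dir v g) p = dir v (dir u g) p"
proof (rule ccontr)
  assume neq: "dir u (dir v g) p \<noteq> dir v (dir u g) p"
  define d where "d = \<bar>dir u (dir v g) p - dir v (dir u g) p\<bar> / 2"
  have "d > 0" using neq by (simp add: d_def)
  have cont: "isCont (dir a (dir b g)) p" for a b
    using assms smooth_on_continuous smooth_on_dir continuous_on_eq_continuous_at by metis
  obtain r1 where r1: "r1 > 0" "\<And>q. dist q p < r1 \<Longrightarrow> dist (dir u (dir v g) q) (dir u (dir v g) p) < d"
    using cont[of u v] \<open>d > 0\<close> unfolding continuous_at_eps_delta by blast
  obtain r2 where r2: "r2 > 0" "\<And>q. dist q p < r2 \<Longrightarrow> dist (dir v (dir u g) q) (dir v (dir u g) p) < d"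
    using cont[of v u] \<open>d > 0\<close> unfolding continuous_at_eps_delta by blast
  obtain r3 where r3: "r3 > 0" "\<And>q. dist q p < r3 \<Longrightarrow> q \<in> S"
    using assms(2,3) unfolding open_dist by blast
  define r where "r = min r1 (min r2 r3)"
  have r: "r > 0" using r1 r2 r3 by (simp add: r_def)
  define e where "e = r / (norm u + norm v + 1)"
  have e: "e > 0" using r by (simp add: e_def add_nonneg_pos)
  have en: "e * (norm u + norm v) < r"
  proof -
    have "e * (norm u + norm v + 1) = r"
      using add_nonneg_pos[of "norm u + norm v" 1] by (simp add: e_def)
    then show ?thesis using e by (simp add: distrib_left)
  qed
  have near: "dist (p + s *\<^sub>R u + t *\<^sub>R v) p < r" if "0 \<le> s" "s \<le> e" "0 \<le> t" "t \<le> e" for s t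
  proof -
    have "dist (p + s *\<^sub>R u + t *\<^sub>R v) p = norm (s *\<^sub>R u + t *\<^sub>R v)"
      by (simp add: dist_norm algebra_simps)
    also have "\<dots> \<le> s * norm u + t * norm v"
      using norm_triangle_ineq[of "s *\<^sub>R u" "t *\<^sub>R v"] that by simp
    also have "\<dots> \<le> e * norm u + e * norm v"
      using that by (intro add_mono mult_right_mono) auto
    finally show ?thesis using en by (simp add: algebra_simps)
  qed
  have in1: "p + s *\<^sub>R u + t *\<^sub>R v \<in> S" if "0 \<le> s" "s \<le> e" "0 \<le> t" "t \<le> e" for s t
    using near[OF that] r3 by (simp add: r_def)
  have in2: "p + t *\<^sub>R v + s *\<^sub>R u \<in> S" if "0 \<le> t" "t \<le> e" "0 \<le> s" "s \<le> e" for s t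
    using in1[of s t] that by (simp add: algebra_simps)
  obtain s1 t1 where 1: "0 \<le> s1" "s1 \<le> e" "0 \<le> t1" "t1 \<le> e"
    "g (p + e *\<^sub>R u + e *\<^sub>R v) - g (p + e *\<^sub>R u) - g (p + e *\<^sub>R v) + g p
      = e * e * dir v (dir u g) (p + s1 *\<^sub>R u + t1 *\<^sub>R v)"
    using second_difference[OF assms(1) e in1] by blast
  obtain s2 t2 where 2: "0 \<le> s2" "s2 \<le> e" "0 \<le> t2" "t2 \<le> e"
    "g (p + e *\<^sub>R v + e *\<^sub>R u) - g (p + e *\<^sub>R v) - g (p + e *\<^sub>R u) + g p
      = e * e * dir u (dir v g) (p + s2 *\<^sub>R v + t2 *\<^sub>R u)"
    using second_difference[OF assms(1) e in2] by blast
  have "e * e * dir v (dir u g) (p + s1 *\<^sub>R u + t1 *\<^sub>R v) = e * e * dir u (dir v g) (p + s2 *\<^sub>R v + t2 *\<^sub>R u)"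
    using 1(5) 2(5) by (simp add: algebra_simps)
  then have eq: "dir v (dir u g) (p + s1 *\<^sub>R u + t1 *\<^sub>R v) = dir u (dir v g) (p + t2 *\<^sub>R u + s2 *\<^sub>R v)"
    using e by (simp add: algebra_simps)
  have "dist (dir v (dir u g) (p + s1 *\<^sub>R u + t1 *\<^sub>R v)) (dir v (dir u g) p) < d"
    using near[OF 1(1-4)] r2 by (simp add: r_def)
  moreover have "dist (dir u (dir v g) (p + t2 *\<^sub>R u + s2 *\<^sub>R v)) (dir u (dir v g) p) < d"
    using near[OF 2(3,4,1,2)] r1 by (simp add: r_def)
  ultimately have "dist (dir u (dir v g) p) (dir v (dir u g) p) < d + d"
    unfolding eq by (metis dist_commute dist_triangle_less_add)
  then show False by (simp add: d_def dist_real_def)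
qed

definition e\<^sub>x :: pt where "e\<^sub>x = (1, 0, 0, 0)"
definition e\<^sub>y :: pt where "e\<^sub>y = (0, 1, 0, 0)"
definition e\<^sub>t :: pt where "e\<^sub>t = (0, 0, 1, 0)"
definition e\<^sub>h :: pt where "e\<^sub>h = (0, 0, 0, 1)"

type_synonym pmulti = "nat \<times> nat \<times> nat \<times> nat"

text \<open>The partial derivative with i, j, k, l derivatives in x, y, t, h. Fixing the order of differentiation
  gives each mixed derivative one normal form, which by Schwarz's theorem (\<open>dir_commute\<close>) is preserved
  by further differentiation.\<close>

fun dm :: "pmulti \<Rightarrow> (pt \<Rightarrow> real) \<Rightarrow> pt \<Rightarrow> real" where
  "dm (i, j, k, l) g = (dir e\<^sub>x ^^ i) ((dir e\<^sub>y ^^ j) ((dir e\<^sub>t ^^ k) ((dir e\<^sub>h ^^ l) g)))"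

declare dm.simps [simp del]

fun pmi_up :: "indep \<Rightarrow> pmulti \<Rightarrow> pmulti" where
  "pmi_up Vx (i, j, k, l) = (Suc i, j, k, l)"
| "pmi_up Vy (i, j, k, l) = (i, Suc j, k, l)"
| "pmi_up Vt (i, j, k, l) = (i, j, Suc k, l)"

fun pmi_up_h :: "pmulti \<Rightarrow> pmulti" where
  "pmi_up_h (i, j, k, l) = (i, j, k, Suc l)"

fun indep_vec :: "indep \<Rightarrow> pt" where
  "indep_vec Vx = e\<^sub>x" | "indep_vec Vy = e\<^sub>y" | "indep_vec Vt = e\<^sub>t"

lemma dm_0 [simp]: "dm (0, 0, 0, 0) g = g"
  by (simp add: dm.simps)

lemma smooth_on_dir_funpow: "smooth_on S g \<Longrightarrow> smooth_on S ((dir v ^^ n) g)"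
  by (induction n) (auto intro: smooth_on_dir)

lemma smooth_on_dm: "smooth_on S g \<Longrightarrow> smooth_on S (dm m g)"
  by (cases m) (auto simp: dm.simps intro!: smooth_on_dir_funpow)

lemma dir_funpow_cong:
  assumes "open S" "\<And>q. q \<in> S \<Longrightarrow> f q = g q"
  shows "p \<in> S \<Longrightarrow> (dir v ^^ n) f p = (dir v ^^ n) g p"
proof (induction n arbitrary: p)
  case (Suc n)
  then show ?case using dir_cong[OF assms(1) Suc.prems, of "(dir v ^^ n) f" "(dir v ^^ n) g" v] by simp
qed (use assms in simp)

lemma dir_funpow_commute:
  assumes "open S" "smooth_on S g"
  shows "p \<in> S \<Longrightarrow> dir v ((dir u ^^ n) g) p = (dir u ^^ n) (dir v g) p"
proof (induction n arbitrary: p)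
  case (Suc n)
  have "dir v ((dir u ^^ Suc n) g) p = dir u (dir v ((dir u ^^ n) g)) p"
    using dir_commute[OF smooth_on_dir_funpow[OF assms(2)] assms(1) Suc.prems] by simp
  also have "\<dots> = dir u ((dir u ^^ n) (dir v g)) p"
    using Suc.IH by (intro dir_cong[OF assms(1) Suc.prems]) auto
  finally show ?case by simp
qed simp

lemma dir_indep_dm:
  assumes "open S" "smooth_on S g" "p \<in> S"
  shows "dir (indep_vec i) (dm m g) p = dm (pmi_up i m) g p"
proof -
  obtain a b c d where m: "m = (a, b, c, d)" by (cases m)
  note sm = smooth_on_dir_funpow smooth_on_dir assms
  show ?thesis
  proof (cases i)
    case Vx
    then show ?thesis by (simp add: m dm.simps)
  next
    case Vy
    then show ?thesis
      using dir_funpow_commute[OF assms(1) _ assms(3), where g="(dir e\<^sub>y ^^ b) ((dir e\<^sub>t ^^ c) ((dir e\<^sub>h ^^ d) g))" and v="e\<^sub>y" and u="e\<^sub>x" and n=a]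
      by (simp add: m dm.simps sm)
  next
    case Vt
    let ?k = "(dir e\<^sub>t ^^ c) ((dir e\<^sub>h ^^ d) g)"
    have "dir e\<^sub>t (dm m g) p = (dir e\<^sub>x ^^ a) (dir e\<^sub>t ((dir e\<^sub>y ^^ b) ?k)) p"
      using dir_funpow_commute[OF assms(1) _ assms(3), where g="(dir e\<^sub>y ^^ b) ?k" and v="e\<^sub>t" and u="e\<^sub>x" and n=a]
      by (simp add: m dm.simps sm)
    also have "\<dots> = (dir e\<^sub>x ^^ a) ((dir e\<^sub>y ^^ b) (dir e\<^sub>t ?k)) p"
      using dir_funpow_commute[OF assms(1), where g="?k"]
      by (intro dir_funpow_cong[OF assms(1) _ assms(3)]) (simp add: sm)
    finally show ?thesis by (simp add: Vt m dm.simps)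
  qed
qed

lemma dir_h_dm:
  assumes "open S" "smooth_on S g" "p \<in> S"
  shows "dir e\<^sub>h (dm m g) p = dm (pmi_up_h m) g p"
proof -
  obtain a b c d where m: "m = (a, b, c, d)" by (cases m)
  note sm = smooth_on_dir_funpow smooth_on_dir assms
  let ?l = "(dir e\<^sub>h ^^ d) g"
  let ?k = "(dir e\<^sub>t ^^ c) ?l"
  have "dir e\<^sub>h (dm m g) p = (dir e\<^sub>x ^^ a) (dir e\<^sub>h ((dir e\<^sub>y ^^ b) ?k)) p"
    using dir_funpow_commute[OF assms(1) _ assms(3), where g="(dir e\<^sub>y ^^ b) ?k" and v="e\<^sub>h" and u="e\<^sub>x" and n=a]
    by (simp add: m dm.simps sm)
  also have "\<dots> = (dir e\<^sub>x ^^ a) ((dir e\<^sub>y ^^ b) (dir e\<^sub>h ?k)) p"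
    using dir_funpow_commute[OF assms(1), where g="?k"]
    by (intro dir_funpow_cong[OF assms(1) _ assms(3)]) (simp add: sm)
  also have "\<dots> = (dir e\<^sub>x ^^ a) ((dir e\<^sub>y ^^ b) ((dir e\<^sub>t ^^ c) (dir e\<^sub>h ?l))) p"
    using dir_funpow_commute[OF assms(1), where g="?l"]
    by (intro dir_funpow_cong[OF assms(1) _ assms(3)] dir_funpow_cong[OF assms(1)]) (simp_all add: sm)
  finally show ?thesis by (simp add: m dm.simps)
qed

fun pmi_add :: "pmulti \<Rightarrow> pmulti \<Rightarrow> pmulti" where
  "pmi_add (i, j, k, l) (i', j', k', l') = (i + i', j + j', k + k', l + l')"

text \<open>A linear relation between two partial derivatives that holds on an open set may be
  differentiated further; the linear integrability conditions below are instances.\<close>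

lemma dm_relation:
  assumes S: "open S" "smooth_on S f" "smooth_on S g"
    and rel: "\<And>p. p \<in> S \<Longrightarrow> dm m f p = c * dm n g p" and "p \<in> S"
  shows "dm (pmi_add m r) f p = c * dm (pmi_add n r) g p"
proof -
  have step: "dir v (dm m f) q = c * dir v (dm n g) q"
    if "\<And>p. p \<in> S \<Longrightarrow> dm m f p = c * dm n g p" "q \<in> S" for m n q v
  proof -
    have "dir v (dm m f) q = dir v (\<lambda>p. c * dm n g p) q"
      using that by (intro dir_cong[OF S(1)]) auto
    then show ?thesis using dir_cmult[OF smooth_on_dm[OF S(3)] that(2)] by simp
  qed
  have ind: "dm (pmi_up i m) f q = c * dm (pmi_up i n) g q"
    if "\<And>p. p \<in> S \<Longrightarrow> dm m f p = c * dm n g p" "q \<in> S" for m n q i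
    using step[OF that, where v="indep_vec i"] dir_indep_dm[OF S(1) _ that(2)] S by simp
  have indh: "dm (pmi_up_h m) f q = c * dm (pmi_up_h n) g q"
    if "\<And>p. p \<in> S \<Longrightarrow> dm m f p = c * dm n g p" "q \<in> S" for m n q
    using step[OF that, where v="e\<^sub>h"] dir_h_dm[OF S(1) _ that(2)] S by simp
  obtain m1 m2 m3 m4 where m: "m = (m1, m2, m3, m4)" by (cases m)
  obtain n1 n2 n3 n4 where n: "n = (n1, n2, n3, n4)" by (cases n)
  obtain i j k l where r: "r = (i, j, k, l)" by (cases r)
  have 1: "q \<in> S \<Longrightarrow> dm (m1 + i, m2, m3, m4) f q = c * dm (n1 + i, n2, n3, n4) g q" for q i
    by (induction i arbitrary: q) (use rel ind[where i=Vx] in \<open>force simp: m n\<close>)+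
  have 2: "q \<in> S \<Longrightarrow> dm (m1 + i, m2 + j, m3, m4) f q = c * dm (n1 + i, n2 + j, n3, n4) g q" for q i j
    by (induction j arbitrary: q) (use 1 ind[where i=Vy] in \<open>force simp: m n\<close>)+
  have 3: "q \<in> S \<Longrightarrow> dm (m1 + i, m2 + j, m3 + k, m4) f q = c * dm (n1 + i, n2 + j, n3 + k, n4) g q" for q i j k
    by (induction k arbitrary: q) (use 2 ind[where i=Vt] in \<open>force simp: m n\<close>)+
  have 4: "q \<in> S \<Longrightarrow> dm (m1 + i, m2 + j, m3 + k, m4 + l) f q
      = c * dm (n1 + i, n2 + j, n3 + k, n4 + l) g q" for q i j k l
    by (induction l arbitrary: q) (use 3 indh in \<open>force simp: m n\<close>)+
  show ?thesis using 4[OF \<open>p \<in> S\<close>] by (simp add: m n r)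
qed


section \<open>Differential polynomials\<close>

text \<open>Polynomials in the jet coordinates whose coefficients are partial derivatives of functions on
  the base: \<open>Co g m\<close> is the derivative m of g, \<open>Jt J\<close> the coordinate \<open>h\<^sub>J\<close>. Everything to be differentiated
  totally is of this form. Keeping the expression rather than the function lets total derivatives
  (\<open>Dj\<close>) be computed by rewriting, with no finiteness or differentiability left to check.\<close>

datatype jexp = Co "pt \<Rightarrow> real" pmulti | Jt multi | Scale real jexp | Add jexp jexp | Mul jexp jexp

fun eval :: "jexp \<Rightarrow> jet \<Rightarrow> real" where
  "eval (Co g m) z = dm m g (jet_pt z)"
| "eval (Jt J) z = z (Dep J)"
| "eval (Scale c a) z = c * eval a z"
| "eval (Add a b) z = eval a z + eval b z"
| "eval (Mul a b) z = eval a z * eval b z"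

fun smooth_coeffs :: "pt set \<Rightarrow> jexp \<Rightarrow> bool" where
  "smooth_coeffs \<Omega> (Co g m) = smooth_on \<Omega> g"
| "smooth_coeffs \<Omega> (Add a b) = (smooth_coeffs \<Omega> a \<and> smooth_coeffs \<Omega> b)"
| "smooth_coeffs \<Omega> (Mul a b) = (smooth_coeffs \<Omega> a \<and> smooth_coeffs \<Omega> b)"
| "smooth_coeffs \<Omega> (Scale c a) = smooth_coeffs \<Omega> a"
| "smooth_coeffs \<Omega> (Jt J) = True"

fun Dj :: "indep \<Rightarrow> jexp \<Rightarrow> jexp" where
  "Dj i (Co g m) = Add (Co g (pmi_up i m)) (Mul (Co g (pmi_up_h m)) (Jt (mi_up i (0, 0, 0))))"
| "Dj i (Jt J) = Jt (mi_up i J)"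
| "Dj i (Scale c a) = Scale c (Dj i a)"
| "Dj i (Add a b) = Add (Dj i a) (Dj i b)"
| "Dj i (Mul a b) = Add (Mul (Dj i a) b) (Mul a (Dj i b))"

fun Dj_multi :: "multi \<Rightarrow> jexp \<Rightarrow> jexp" where
  "Dj_multi (a, b, c) e = (Dj Vx ^^ a) ((Dj Vy ^^ b) ((Dj Vt ^^ c) e))"

fun partial_jexp :: "coord \<Rightarrow> jexp \<Rightarrow> jet \<Rightarrow> real" where
  "partial_jexp c (Co g m) z = (case c of Base i \<Rightarrow> dm (pmi_up i m) g (jet_pt z)
      | Dep J \<Rightarrow> if J = (0, 0, 0) then dm (pmi_up_h m) g (jet_pt z) else 0)"
| "partial_jexp c (Jt J) z = (if c = Dep J then 1 else 0)"
| "partial_jexp c (Scale r a) z = r * partial_jexp c a z"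
| "partial_jexp c (Add a b) z = partial_jexp c a z + partial_jexp c b z"
| "partial_jexp c (Mul a b) z = partial_jexp c a z * eval b z + eval a z * partial_jexp c b z"

fun jvars :: "jexp \<Rightarrow> multi set" where
  "jvars (Co g m) = {(0, 0, 0)}"
| "jvars (Jt J) = {J}"
| "jvars (Scale c a) = jvars a"
| "jvars (Add a b) = jvars a \<union> jvars b"
| "jvars (Mul a b) = jvars a \<union> jvars b"

lemma smooth_coeffs_Dj: "smooth_coeffs \<Omega> e \<Longrightarrow> smooth_coeffs \<Omega> (Dj i e)"
  by (induction e) auto

lemma finite_jvars: "finite (jvars e)"
  by (induction e) auto

lemma partial_jexp_not_jvars: "J \<notin> jvars e \<Longrightarrow> partial_jexp (Dep J) e z = 0"
  by (induction e) auto

definition coord_vec :: "coord \<Rightarrow> pt" where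
  "coord_vec c = (case c of Base i \<Rightarrow> indep_vec i | Dep J \<Rightarrow> if J = (0, 0, 0) then e\<^sub>h else 0)"

lemma jet_pt_upd: "jet_pt (z(c := s)) = (jet_pt z - z c *\<^sub>R coord_vec c) + s *\<^sub>R coord_vec c"
proof (cases c)
  case (Base i)
  then show ?thesis
    by (cases i) (simp_all add: jet_pt_def coord_vec_def e\<^sub>x_def e\<^sub>y_def e\<^sub>t_def)
next
  case (Dep J)
  show ?thesis
  proof (cases "J = (0, 0, 0)")
    case True
    then show ?thesis by (simp add: Dep jet_pt_def coord_vec_def e\<^sub>h_def)
  next
    case False
    then have "jet_pt (z(c := s)) = jet_pt z" by (simp add: Dep jet_pt_def)
    then show ?thesis using False by (simp add: Dep coord_vec_def)
  qed
qed

lemma dir_0: "smooth_on S g \<Longrightarrow> p \<in> S \<Longrightarrow> dir 0 g p = 0"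
  by (rule linear_0[OF has_derivative_linear[OF smooth_on_has_derivative]])

lemma eval_has_partial_jexp:
  assumes "open \<Omega>" "smooth_coeffs \<Omega> e" "jet_pt z \<in> \<Omega>"
  shows "((\<lambda>s. eval e (z(c := s))) has_real_derivative partial_jexp c e z) (at (z c))"
  using assms(2)
proof (induction e)
  case (Co g m)
  have sm: "smooth_on \<Omega> (dm m g)" using Co by (simp add: smooth_on_dm)
  have "((\<lambda>s. eval (Co g m) (z(c := s))) has_real_derivative dir (coord_vec c) (dm m g) (jet_pt z)) (at (z c))"
    using smooth_line_derivative[OF sm, of "jet_pt z - z c *\<^sub>R coord_vec c" "z c" "coord_vec c"] assms(3)
    by (simp add: jet_pt_upd)
  moreover have "dir (coord_vec c) (dm m g) (jet_pt z) = partial_jexp c (Co g m) z"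
    using Co dir_indep_dm[OF assms(1) _ assms(3)] dir_h_dm[OF assms(1) _ assms(3)] dir_0[OF sm assms(3)]
    by (auto simp: coord_vec_def split: coord.split)
  ultimately show ?case by (simp only:)
next
  case (Jt J)
  then show ?case by (cases "c = Dep J") auto
qed (auto intro!: derivative_eq_intros)

lemma partial_deriv_eval:
  assumes "open \<Omega>" "smooth_coeffs \<Omega> e" "jet_pt z \<in> \<Omega>"
    and F: "\<And>z. jet_pt z \<in> \<Omega> \<Longrightarrow> F z = eval e z"
  shows "partial_deriv c F z = partial_jexp c e z"
proof -
  let ?g = "\<lambda>s. jet_pt z - z c *\<^sub>R coord_vec c + s *\<^sub>R coord_vec c"
  have "continuous_on UNIV ?g" by (intro continuous_intros)
  then have "open (?g -` \<Omega>)" using assms(1) by (rule open_vimage[rotated])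
  moreover have "z c \<in> ?g -` \<Omega>" using assms(3) by simp
  moreover have "eval e (z(c := s)) = F (z(c := s))" if "s \<in> ?g -` \<Omega>" for s
    using F[of "z(c := s)"] that by (simp only: jet_pt_upd vimage_eq)
  ultimately have "((\<lambda>s. F (z(c := s))) has_real_derivative partial_jexp c e z) (at (z c))"
    by (intro has_field_derivative_transform_within_open[OF eval_has_partial_jexp[OF assms(1-3)]])
  then show ?thesis by (simp add: partial_deriv_def DERIV_imp_deriv)
qed

text \<open>The index set of the sum in \<open>total_deriv\<close> depends on the jet z; a fixed finite superset allows
  induction on the expression.\<close>

lemma eval_Dj:
  assumes "finite S" "jvars e \<subseteq> S"
  shows "eval (Dj i e) z = partial_jexp (Base i) e z + (\<Sum>J\<in>S. z (Dep (mi_up i J)) * partial_jexp (Dep J) e z)"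
  using assms(2)
proof (induction e)
  case (Co g m)
  have "(\<Sum>J\<in>S. z (Dep (mi_up i J)) * partial_jexp (Dep J) (Co g m) z)
      = (\<Sum>J\<in>S. if J = (0, 0, 0) then z (Dep (mi_up i (0, 0, 0))) * dm (pmi_up_h m) g (jet_pt z) else 0)"
    by (intro sum.cong) auto
  then show ?case using Co assms(1) by (simp add: sum.delta del: mi_up.simps)
next
  case (Jt K)
  have "(\<Sum>J\<in>S. z (Dep (mi_up i J)) * partial_jexp (Dep J) (Jt K) z)
      = (\<Sum>J\<in>S. if J = K then z (Dep (mi_up i K)) else 0)"
    by (intro sum.cong) auto
  then show ?case using Jt assms(1) by (simp add: sum.delta del: mi_up.simps)
next
  case (Add a b)
  then show ?case by (simp add: distrib_left sum.distrib)
next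
  case (Mul a b)
  then show ?case
    by (simp add: algebra_simps sum.distrib sum_distrib_left)
next
  case (Scale c a)
  then show ?case
    by (simp add: algebra_simps sum_distrib_left)
qed

lemma total_deriv_eval:
  assumes "open \<Omega>" "smooth_coeffs \<Omega> e" "\<And>z. jet_pt z \<in> \<Omega> \<Longrightarrow> F z = eval e z" "jet_pt z \<in> \<Omega>"
  shows "total_deriv i F z = eval (Dj i e) z"
proof -
  have pd: "partial_deriv c F z = partial_jexp c e z" for c
    using partial_deriv_eval assms by blast
  have sub: "{J. partial_jexp (Dep J) e z \<noteq> 0} \<subseteq> jvars e"
    using partial_jexp_not_jvars by blast
  have "(\<Sum>J | partial_jexp (Dep J) e z \<noteq> 0. z (Dep (mi_up i J)) * partial_jexp (Dep J) e z)
      = (\<Sum>J\<in>jvars e. z (Dep (mi_up i J)) * partial_jexp (Dep J) e z)"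
    by (rule sum.mono_neutral_left) (use finite_jvars sub in auto)
  then show ?thesis
    unfolding total_deriv_def pd by (simp add: eval_Dj[OF finite_jvars subset_refl])
qed

lemma total_deriv_funpow_eval:
  assumes "open \<Omega>" "smooth_coeffs \<Omega> e" "\<And>z. jet_pt z \<in> \<Omega> \<Longrightarrow> F z = eval e z"
  shows "smooth_coeffs \<Omega> ((Dj i ^^ n) e) \<and>
    (\<forall>z. jet_pt z \<in> \<Omega> \<longrightarrow> (total_deriv i ^^ n) F z = eval ((Dj i ^^ n) e) z)"
proof (induction n)
  case (Suc n)
  then show ?case
    using total_deriv_eval[OF assms(1), of "(Dj i ^^ n) e" "(total_deriv i ^^ n) F"]
    by (auto intro: smooth_coeffs_Dj)
qed (use assms in auto)

text \<open>Iteration is possible because F and the expression need to agree over an open set only, and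
  total differentiation preserves this agreement.\<close>

lemma total_deriv_multi_eval:
  assumes "open \<Omega>" "smooth_coeffs \<Omega> e" "\<And>z. jet_pt z \<in> \<Omega> \<Longrightarrow> F z = eval e z" "jet_pt z \<in> \<Omega>"
  shows "total_deriv_multi J F z = eval (Dj_multi J e) z"
proof -
  obtain a b c where J: "J = (a, b, c)" by (cases J)
  note 1 = total_deriv_funpow_eval[OF assms(1-3), where i=Vt and n=c]
  note 2 = total_deriv_funpow_eval[OF assms(1), where e="(Dj Vt ^^ c) e"
      and F="(total_deriv Vt ^^ c) F" and i=Vy and n=b]
  note 3 = total_deriv_funpow_eval[OF assms(1), where e="(Dj Vy ^^ b) ((Dj Vt ^^ c) e)"
      and F="(total_deriv Vy ^^ b) ((total_deriv Vt ^^ c) F)" and i=Vx and n=a]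
  show ?thesis using 1 2 3 assms(4) by (simp add: J)
qed

section \<open>The prolonged action on the equation\<close>

lemma partial_deriv_Delta1:
  "partial_deriv (Dep J) (Delta1 nu kappa lam) z =
     (if J = (0, 0, 1) then 1 else 0)
     - nu * ((if J = (2, 0, 0) then 1 else 0) + (if J = (0, 2, 0) then 1 else 0))
     + kappa * ((if J = (4, 0, 0) then 1 else 0) + 2 * (if J = (2, 2, 0) then 1 else 0)
         + (if J = (0, 4, 0) then 1 else 0))
     - 2 * lam * (z (Dep (1, 0, 0)) * (if J = (1, 0, 0) then 1 else 0)
         + z (Dep (0, 1, 0)) * (if J = (0, 1, 0) then 1 else 0))"
proof -
  have D: "((\<lambda>s. (z(Dep J := s)) (Dep K)) has_real_derivative (if J = K then 1 else 0)) (at (z (Dep J)))" for K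
    by (cases "J = K") auto
  show ?thesis
    unfolding partial_deriv_def Delta1_def
    by (rule DERIV_imp_deriv) (rule derivative_eq_intros D refl | simp)+
qed

lemma partial_deriv_Delta1_Base: "partial_deriv (Base i) (Delta1 nu kappa lam) z = 0"
  unfolding partial_deriv_def Delta1_def by simp

lemma finite_mi_order: "finite {J. mi_order J \<le> n}"
proof (rule finite_subset)
  show "{J. mi_order J \<le> n} \<subseteq> {..n} \<times> {..n} \<times> {..n}" by auto
qed auto

lemma prolong_Delta1:
  "prolong 4 V (Delta1 nu kappa lam) z = prolong_coeff V (0, 0, 1) z
     - nu * (prolong_coeff V (2, 0, 0) z + prolong_coeff V (0, 2, 0) z)
     + kappa * (prolong_coeff V (4, 0, 0) z + 2 * prolong_coeff V (2, 2, 0) z + prolong_coeff V (0, 4, 0) z)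
     - 2 * lam * (z (Dep (1, 0, 0)) * prolong_coeff V (1, 0, 0) z
         + z (Dep (0, 1, 0)) * prolong_coeff V (0, 1, 0) z)"
proof -
  let ?A = "{J. mi_order J \<le> 4}"
  have pick: "(\<Sum>J\<in>?A. c * (prolong_coeff V J z * (if J = K then 1 else 0))) = c * prolong_coeff V K z"
    if "mi_order K \<le> 4" for K c
  proof -
    have "(\<Sum>J\<in>?A. c * (prolong_coeff V J z * (if J = K then 1 else 0)))
        = (\<Sum>J\<in>?A. if J = K then c * prolong_coeff V K z else 0)"
      by (intro sum.cong) auto
    then show ?thesis using that finite_mi_order[of 4] by (simp add: sum.delta)
  qed
  have "(\<Sum>J\<in>?A. prolong_coeff V J z * partial_deriv (Dep J) (Delta1 nu kappa lam) z) =
      (\<Sum>J\<in>?A. 1 * (prolong_coeff V J z * (if J = (0, 0, 1) then 1 else 0))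
        + (- nu) * (prolong_coeff V J z * (if J = (2, 0, 0) then 1 else 0))
        + (- nu) * (prolong_coeff V J z * (if J = (0, 2, 0) then 1 else 0))
        + kappa * (prolong_coeff V J z * (if J = (4, 0, 0) then 1 else 0))
        + (2 * kappa) * (prolong_coeff V J z * (if J = (2, 2, 0) then 1 else 0))
        + kappa * (prolong_coeff V J z * (if J = (0, 4, 0) then 1 else 0))
        + (- 2 * lam * z (Dep (1, 0, 0))) * (prolong_coeff V J z * (if J = (1, 0, 0) then 1 else 0))
        + (- 2 * lam * z (Dep (0, 1, 0))) * (prolong_coeff V J z * (if J = (0, 1, 0) then 1 else 0)))"
    unfolding partial_deriv_Delta1 by (intro sum.cong refl) (simp add: algebra_simps)
  also have "\<dots> = 1 * prolong_coeff V (0, 0, 1) z + (- nu) * prolong_coeff V (2, 0, 0) z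
        + (- nu) * prolong_coeff V (0, 2, 0) z + kappa * prolong_coeff V (4, 0, 0) z
        + (2 * kappa) * prolong_coeff V (2, 2, 0) z + kappa * prolong_coeff V (0, 4, 0) z
        + (- 2 * lam * z (Dep (1, 0, 0))) * prolong_coeff V (1, 0, 0) z
        + (- 2 * lam * z (Dep (0, 1, 0))) * prolong_coeff V (0, 1, 0) z"
    unfolding sum.distrib by (subst pick, simp)+ simp
  finally show ?thesis
    unfolding prolong_def partial_deriv_Delta1_Base by (simp add: algebra_simps)
qed

text \<open>The right-hand side u of the invariant surface condition \<open>h\<^sub>t = u\<close> for \<open>\<xi>\<^sup>3 = 1\<close>; it contains no
  derivatives in t.\<close>

definition spatial_characteristic :: "vfield \<Rightarrow> jexp" where
  "spatial_characteristic V = Add (Co (phi V) (0, 0, 0, 0))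
     (Scale (-1) (Add (Mul (Co (xi1 V) (0, 0, 0, 0)) (Jt (1, 0, 0)))
                      (Mul (Co (xi2 V) (0, 0, 0, 0)) (Jt (0, 1, 0)))))"

definition characteristic :: "vfield \<Rightarrow> jexp" where
  "characteristic V = Add (spatial_characteristic V)
     (Scale (-1) (Mul (Co (xi3 V) (0, 0, 0, 0)) (Jt (0, 0, 1))))"

lemma Delta2_eval: "Delta2 V z = eval (characteristic V) z"
  by (simp add: Delta2_def characteristic_def spatial_characteristic_def)

lemma smooth_coeffs_characteristic: "smooth_vfield \<Omega> V \<Longrightarrow> smooth_coeffs \<Omega> (characteristic V)"
  by (simp add: smooth_vfield_def characteristic_def spatial_characteristic_def)

lemma total_deriv_multi_Delta2:
  assumes "open \<Omega>" "smooth_vfield \<Omega> V" "jet_pt z \<in> \<Omega>"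
  shows "total_deriv_multi J (Delta2 V) z = eval (Dj_multi J (characteristic V)) z"
  using total_deriv_multi_eval[OF assms(1) smooth_coeffs_characteristic[OF assms(2)] Delta2_eval assms(3)] .


section \<open>Rescaling a nonclassical symmetry\<close>

inductive jspan :: "jexp set \<Rightarrow> jexp \<Rightarrow> bool" for S where
  gen: "e \<in> S \<Longrightarrow> jspan S e"
| mult: "jspan S e \<Longrightarrow> jspan S (Mul c e)"
| add: "jspan S a \<Longrightarrow> jspan S b \<Longrightarrow> jspan S (Add a b)"

lemma jspan_Dj:
  assumes "\<And>e. e \<in> S \<Longrightarrow> Dj i e \<in> S"
  shows "jspan S e \<Longrightarrow> jspan S ((Dj i ^^ n) e)"
proof (induction n)
  case (Suc n)
  have "jspan S a \<Longrightarrow> jspan S (Dj i a)" for a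
    by (induction rule: jspan.induct) (auto intro: jspan.intros assms)
  then show ?case using Suc by simp
qed simp

lemma jspan_mono: "jspan S e \<Longrightarrow> S \<subseteq> T \<Longrightarrow> jspan T e"
  by (induction rule: jspan.induct) (auto intro: jspan.intros)

lemma jspan_eval_0: "jspan S e \<Longrightarrow> (\<And>a. a \<in> S \<Longrightarrow> eval a z = 0) \<Longrightarrow> eval e z = 0"
  by (induction rule: jspan.induct) auto

text \<open>By the product rule, the differential ideal generated by an expression is closed under
  total differentiation and under multiplication. The total derivatives are applied in the fixed
  order t, y, x, hence one module for each stage.\<close>

lemma Dj_multi_Mul_0:
  assumes "\<And>J. eval (Dj_multi J e) z = 0"
  shows "eval (Dj_multi J (Mul f e)) z = 0"
proof -
  obtain a b c where J: "J = (a, b, c)" by (cases J)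
  let ?S1 = "{(Dj Vt ^^ k) e | k. True}"
  let ?S2 = "{(Dj Vy ^^ j) ((Dj Vt ^^ k) e) | j k. True}"
  let ?S3 = "{(Dj Vx ^^ i) ((Dj Vy ^^ j) ((Dj Vt ^^ k) e)) | i j k. True}"
  have "e \<in> ?S1" by (auto intro: exI[of _ 0])
  then have "jspan ?S1 (Mul f e)" by (intro jspan.intros)
  then have "jspan ?S1 ((Dj Vt ^^ c) (Mul f e))"
    by (rule jspan_Dj[rotated]) (clarsimp, metis funpow.simps(2) comp_apply)
  moreover have "?S1 \<subseteq> ?S2" by (clarsimp, metis funpow_0)
  ultimately have "jspan ?S2 ((Dj Vt ^^ c) (Mul f e))" by (rule jspan_mono)
  then have "jspan ?S2 ((Dj Vy ^^ b) ((Dj Vt ^^ c) (Mul f e)))"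
    by (rule jspan_Dj[rotated]) (clarsimp, metis funpow.simps(2) comp_apply)
  moreover have "?S2 \<subseteq> ?S3" by (clarsimp, metis funpow_0)
  ultimately have "jspan ?S3 ((Dj Vy ^^ b) ((Dj Vt ^^ c) (Mul f e)))" by (rule jspan_mono)
  then have "jspan ?S3 ((Dj Vx ^^ a) ((Dj Vy ^^ b) ((Dj Vt ^^ c) (Mul f e))))"
    by (rule jspan_Dj[rotated]) (clarsimp, metis funpow.simps(2) comp_apply)
  then show ?thesis
    unfolding J Dj_multi.simps by (rule jspan_eval_0) (use assms in force)
qed

text \<open>A multiple of W has the multiple of its characteristic, which lies in the same differential ideal.\<close>

lemma total_deriv_multi_Delta2_multiple:
  assumes "open \<Omega>" "smooth_on \<Omega> f" "smooth_vfield \<Omega> W" "multiple_on \<Omega> f W V"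
    and "jet_pt z \<in> \<Omega>" "\<forall>J. total_deriv_multi J (Delta2 W) z = 0"
  shows "total_deriv_multi J (Delta2 V) z = 0"
proof -
  let ?e = "Mul (Co f (0, 0, 0, 0)) (characteristic W)"
  have "total_deriv_multi J (Delta2 V) z = eval (Dj_multi J ?e) z"
  proof (rule total_deriv_multi_eval[OF assms(1) _ _ assms(5)])
    show "smooth_coeffs \<Omega> ?e" using assms(2) smooth_coeffs_characteristic[OF assms(3)] by simp
    show "Delta2 V z = eval ?e z" if "jet_pt z \<in> \<Omega>" for z
      using assms(4) that by (simp add: multiple_on_def Delta2_def Delta2_eval[symmetric] algebra_simps)
  qed
  also have "\<dots> = 0"
    using assms(6) total_deriv_multi_Delta2[OF assms(1,3,5)] by (intro Dj_multi_Mul_0) metis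
  finally show ?thesis .
qed

text \<open>Where \<open>Delta2 V\<close> and its consequences vanish, the prolongation coefficients reduce to
  \<open>\<Sum>\<^sub>i \<xi>\<^sup>i h\<^sub>J\<^sub>,\<^sub>i\<close> and depend linearly on V over functions, so a nonvanishing factor is harmless.\<close>

lemma nonclassical_symmetry_multiple:
  assumes "open \<Omega>" "smooth_on \<Omega> f" "\<And>p. p \<in> \<Omega> \<Longrightarrow> f p \<noteq> 0" "smooth_vfield \<Omega> V"
    and "multiple_on \<Omega> f W V" "nonclassical_symmetry nu kappa lam \<Omega> W"
  shows "nonclassical_symmetry nu kappa lam \<Omega> V"
  unfolding nonclassical_symmetry_def
proof (intro conjI allI impI)
  fix z assume z: "jet_pt z \<in> \<Omega> \<and> Delta1 nu kappa lam z = 0 \<and> (\<forall>J. total_deriv_multi J (Delta2 V) z = 0)"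
  have "smooth_on \<Omega> (\<lambda>p. 1 / f p)"
    using smooth_on_divide[OF assms(1) smooth_on_const assms(2,3)] by simp
  moreover have "multiple_on \<Omega> (\<lambda>p. 1 / f p) V W"
    using assms(3,5) by (simp add: multiple_on_def)
  ultimately have W: "\<forall>J. total_deriv_multi J (Delta2 W) z = 0"
    using total_deriv_multi_Delta2_multiple[OF assms(1) _ assms(4)] z by blast
  have "prolong_coeff V J z = f (jet_pt z) * prolong_coeff W J z" for J
  proof -
    have "total_deriv_multi J (Delta2 V) z = 0" "total_deriv_multi J (Delta2 W) z = 0" "jet_pt z \<in> \<Omega>"
      using z W by blast+
    then show ?thesis
      using assms(5) by (simp add: prolong_coeff_def multiple_on_def distrib_left mult.assoc)
  qed
  then have "prolong 4 V (Delta1 nu kappa lam) z = f (jet_pt z) * prolong 4 W (Delta1 nu kappa lam) z"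
    by (simp add: prolong_Delta1 algebra_simps)
  then show "prolong 4 V (Delta1 nu kappa lam) z = 0"
    using assms(6) z W unfolding nonclassical_symmetry_def by (metis mult_zero_right)
qed (rule assms)


section \<open>Jets on the invariant surface\<close>

fun t_order_le :: "nat \<Rightarrow> jexp \<Rightarrow> bool" where
  "t_order_le n (Co g m) = True"
| "t_order_le n (Jt J) = (snd (snd J) \<le> n)"
| "t_order_le n (Scale c a) = t_order_le n a"
| "t_order_le n (Add a b) = (t_order_le n a \<and> t_order_le n b)"
| "t_order_le n (Mul a b) = (t_order_le n a \<and> t_order_le n b)"

lemma t_order_le_Dj_space: "i \<noteq> Vt \<Longrightarrow> t_order_le n e \<Longrightarrow> t_order_le n (Dj i e)"
proof (induction e)
  case (Co g m)
  then show ?case by (cases i) auto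
next
  case (Jt J)
  then show ?case by (cases i; cases J) auto
qed auto

lemma t_order_le_Dj_t: "t_order_le n e \<Longrightarrow> t_order_le (Suc n) (Dj Vt e)"
proof (induction e)
  case (Jt J)
  then show ?case by (cases J) auto
next
  case (Mul a b)
  moreover have "t_order_le n e \<Longrightarrow> t_order_le (Suc n) e" for e by (induction e) auto
  ultimately show ?case by auto
qed auto

lemma t_order_le_Dj_multi:
  assumes "t_order_le 0 e"
  shows "t_order_le c (Dj_multi (a, b, c) e)"
proof -
  have 1: "t_order_le n ((Dj Vt ^^ n) e)" for n
    by (induction n) (auto intro: assms t_order_le_Dj_t)
  have 2: "t_order_le c e \<Longrightarrow> t_order_le c ((Dj i ^^ n) e)" if "i \<noteq> Vt" for i n e
    by (induction n) (auto intro: t_order_le_Dj_space[OF that])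
  show ?thesis by (simp add: 1 2)
qed

lemma eval_cong_t_order:
  assumes "t_order_le n e" "\<And>i. z (Base i) = z' (Base i)"
    "\<And>a b c. c \<le> n \<Longrightarrow> z (Dep (a, b, c)) = z' (Dep (a, b, c))"
  shows "eval e z = eval e z'"
  using assms(1)
proof (induction e)
  case (Co g m)
  have "jet_pt z = jet_pt z'" using assms(2,3) by (simp add: jet_pt_def)
  then show ?case by simp
next
  case (Jt J)
  then show ?case using assms(3) by (cases J) auto
qed auto

text \<open>After n steps the jet coordinates with at most n derivatives in t have their final values; the
  others are still those of the initial jet.\<close>

primrec evolve :: "jexp \<Rightarrow> jet \<Rightarrow> nat \<Rightarrow> jet" where
  "evolve u z 0 = z"
| "evolve u z (Suc n) = (\<lambda>c. case c of Base i \<Rightarrow> z (Base i)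
     | Dep (a, b, k) \<Rightarrow> if k = Suc n then eval (Dj_multi (a, b, n) u) (evolve u z n)
         else evolve u z n (Dep (a, b, k)))"

text \<open>The evolution equation \<open>h\<^sub>t = u\<close> has a formal solution with arbitrary initial jet: the
  derivatives with n + 1 derivatives in t are determined by those with at most n.\<close>

lemma formal_evolution:
  assumes "t_order_le 0 u"
  shows "\<exists>z. (\<forall>i. z (Base i) = z0 (Base i)) \<and> (\<forall>a b. z (Dep (a, b, 0)) = z0 (Dep (a, b, 0)))
    \<and> (\<forall>a b c. z (Dep (a, b, Suc c)) = eval (Dj_multi (a, b, c) u) z)"
proof -
  define z where "z = (\<lambda>c. case c of Base i \<Rightarrow> z0 (Base i) | Dep (a, b, k) \<Rightarrow> evolve u z0 k (Dep (a, b, k)))"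
  have base: "evolve u z0 n (Base i) = z0 (Base i)" for n i
    by (cases n) auto
  have stable: "k \<le> n \<Longrightarrow> evolve u z0 n (Dep (a, b, k)) = evolve u z0 k (Dep (a, b, k))" for a b k n
    by (induction n) (auto simp: le_Suc_eq)
  have "z (Dep (a, b, Suc c)) = eval (Dj_multi (a, b, c) u) z" for a b c
  proof -
    have "z (Dep (a, b, Suc c)) = eval (Dj_multi (a, b, c) u) (evolve u z0 c)"
      by (simp add: z_def)
    also have "\<dots> = eval (Dj_multi (a, b, c) u) z"
    proof (rule eval_cong_t_order[OF t_order_le_Dj_multi[OF assms]])
      show "evolve u z0 c (Dep (a', b', k)) = z (Dep (a', b', k))" if "k \<le> c" for a' b' k
        using stable[OF that] by (simp add: z_def)
    qed (simp add: z_def base)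
    finally show ?thesis .
  qed
  moreover have "z (Base i) = z0 (Base i)" "z (Dep (a, b, 0)) = z0 (Dep (a, b, 0))" for i a b
    by (simp_all add: z_def)
  ultimately show ?thesis by blast
qed

lemma Dj_funpow_Add: "(Dj i ^^ n) (Add a b) = Add ((Dj i ^^ n) a) ((Dj i ^^ n) b)"
  by (induction n) auto

lemma Dj_funpow_Scale: "(Dj i ^^ n) (Scale c a) = Scale c ((Dj i ^^ n) a)"
  by (induction n) auto

lemma Dj_multi_Jt: "Dj_multi (a, b, c) (Jt (0, 0, 1)) = Jt (a, b, Suc c)"
proof -
  have "(Dj Vt ^^ c) (Jt (0, 0, 1)) = Jt (0, 0, Suc c)" by (induction c) auto
  moreover have "(Dj Vy ^^ b) (Jt (0, 0, Suc c)) = Jt (0, b, Suc c)" by (induction b) auto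
  moreover have "(Dj Vx ^^ a) (Jt (0, b, Suc c)) = Jt (a, b, Suc c)" by (induction a) auto
  ultimately show ?thesis by simp
qed

lemma exists_jet_on_invariant_surface:
  assumes "open \<Omega>" "smooth_vfield \<Omega> V" "\<forall>p\<in>\<Omega>. xi3 V p = 1"
    and "(x, y, t, w 0 0) \<in> \<Omega>"
  shows "\<exists>z. jet_pt z = (x, y, t, w 0 0) \<and> (\<forall>a b. z (Dep (a, b, 0)) = w a b)
    \<and> (\<forall>J. total_deriv_multi J (Delta2 V) z = 0)"
proof -
  let ?u = "spatial_characteristic V"
  define z0 :: jet where "z0 = (\<lambda>c. case c of Base Vx \<Rightarrow> x | Base Vy \<Rightarrow> y | Base Vt \<Rightarrow> t
     | Dep (a, b, c) \<Rightarrow> w a b)"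
  have "t_order_le 0 ?u" by (simp add: spatial_characteristic_def)
  then obtain z where z: "\<And>i. z (Base i) = z0 (Base i)" "\<And>a b. z (Dep (a, b, 0)) = z0 (Dep (a, b, 0))"
    "\<And>a b c. z (Dep (a, b, Suc c)) = eval (Dj_multi (a, b, c) ?u) z"
    using formal_evolution[of ?u z0] by blast
  have pt: "jet_pt z = (x, y, t, w 0 0)" by (simp add: jet_pt_def z(1,2) z0_def)
  let ?e = "Add ?u (Scale (-1) (Jt (0, 0, 1)))"
  have e: "Delta2 V z = eval ?e z" if "jet_pt z \<in> \<Omega>" for z
    using assms(3) that by (simp add: Delta2_eval characteristic_def)
  have sm: "smooth_coeffs \<Omega> ?e"
    using smooth_coeffs_characteristic[OF assms(2)] by (simp add: characteristic_def)
  have "total_deriv_multi J (Delta2 V) z = 0" for J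
  proof -
    obtain a b c where J: "J = (a, b, c)" by (cases J)
    have "total_deriv_multi J (Delta2 V) z = eval (Dj_multi J ?e) z"
      using total_deriv_multi_eval[OF assms(1) sm e] assms(4) pt by simp
    also have "\<dots> = eval (Dj_multi J ?u) z - eval (Dj_multi J (Jt (0, 0, 1))) z"
      by (simp add: J Dj_funpow_Add Dj_funpow_Scale)
    also have "\<dots> = 0" by (simp only: J Dj_multi_Jt z(3) eval.simps diff_self)
    finally show ?thesis .
  qed
  then show ?thesis using pt z(2) by (intro exI[of _ z]) (simp add: z0_def)
qed

section \<open>The determining equations\<close>

text \<open>At jets with \<open>h\<^sub>x = h\<^sub>y = 0\<close> whose only other nonzero space derivatives up to order four are \<open>h\<^sub>x\<^sub>x\<close>, \<open>h\<^sub>x\<^sub>x\<^sub>x\<close> and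
  \<open>h\<^sub>y\<^sub>y\<^sub>y\<^sub>y\<close>, the fourth prolongation keeps just the two quadratic terms that detect the dependence of V on h.
  The derivative \<open>h\<^sub>y\<^sub>y\<^sub>y\<^sub>y\<close> is present so that \<open>Delta1 = 0\<close> can be satisfied.\<close>

lemma prolong_special_jet_x:
  assumes "open \<Omega>" "smooth_vfield \<Omega> V" "jet_pt z = p" "p \<in> \<Omega>"
    and tau: "\<And>i j k l. dm (Suc i, j, k, l) (xi3 V) p = 0" "\<And>i j k l. dm (i, Suc j, k, l) (xi3 V) p = 0"
      "\<And>i j k l. dm (i, j, Suc k, l) (xi3 V) p = 0" "\<And>i j k l. dm (i, j, k, Suc l) (xi3 V) p = 0"
    and z: "\<And>a b. z (Dep (a, b, 0)) = w a b"
    and w: "w 1 0 = 0" "w 0 1 = 0" "w 1 1 = 0" "w 0 2 = 0" "w 2 1 = 0" "w 1 2 = 0" "w 0 3 = 0"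
      "w 4 0 = 0" "w 3 1 = 0" "w 2 2 = 0" "w 1 3 = 0"
  shows "prolong 4 V (Delta1 nu kappa lam) z =
    dm (0, 0, 1, 0) (phi V) p + dm (0, 0, 0, 1) (phi V) p * z (Dep (0, 0, 1))
    - nu * (dm (2, 0, 0, 0) (phi V) p + dm (0, 2, 0, 0) (phi V) p
        + (dm (0, 0, 0, 1) (phi V) p - 2 * dm (1, 0, 0, 0) (xi1 V) p) * w 2 0)
    + kappa * (dm (4, 0, 0, 0) (phi V) p + 2 * dm (2, 2, 0, 0) (phi V) p + dm (0, 4, 0, 0) (phi V) p)
    + kappa * (6 * dm (2, 0, 0, 1) (phi V) p + 2 * dm (0, 2, 0, 1) (phi V) p
        - 4 * dm (3, 0, 0, 0) (xi1 V) p - 4 * dm (1, 2, 0, 0) (xi1 V) p) * w 2 0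
    + kappa * (4 * dm (1, 0, 0, 1) (phi V) p - 6 * dm (2, 0, 0, 0) (xi1 V) p - 2 * dm (0, 2, 0, 0) (xi1 V) p) * w 3 0
    + (dm (0, 0, 0, 1) (phi V) p - 4 * dm (0, 1, 0, 0) (xi2 V) p) * (kappa * w 0 4)
    + kappa * (3 * dm (0, 0, 0, 2) (phi V) p - 12 * dm (1, 0, 0, 1) (xi1 V) p) * (w 2 0 * w 2 0)
    - kappa * (10 * dm (0, 0, 0, 1) (xi1 V) p) * (w 2 0 * w 3 0)"
  unfolding prolong_Delta1 prolong_coeff_def total_deriv_multi_Delta2[OF assms(1,2) assms(4)[folded assms(3)]]
    characteristic_def spatial_characteristic_def
  using w by (simp add: tau z assms(3) eval_nat_numeral) (simp add: algebra_simps)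

lemma prolong_special_jet_y:
  assumes "open \<Omega>" "smooth_vfield \<Omega> V" "jet_pt z = p" "p \<in> \<Omega>"
    and tau: "\<And>i j k l. dm (Suc i, j, k, l) (xi3 V) p = 0" "\<And>i j k l. dm (i, Suc j, k, l) (xi3 V) p = 0"
      "\<And>i j k l. dm (i, j, Suc k, l) (xi3 V) p = 0" "\<And>i j k l. dm (i, j, k, Suc l) (xi3 V) p = 0"
    and z: "\<And>a b. z (Dep (a, b, 0)) = w a b"
    and w: "w 1 0 = 0" "w 0 1 = 0" "w 1 1 = 0" "w 2 0 = 0" "w 2 1 = 0" "w 1 2 = 0" "w 3 0 = 0"
      "w 0 4 = 0" "w 3 1 = 0" "w 2 2 = 0" "w 1 3 = 0"
  shows "prolong 4 V (Delta1 nu kappa lam) z =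
    dm (0, 0, 1, 0) (phi V) p + dm (0, 0, 0, 1) (phi V) p * z (Dep (0, 0, 1))
    - nu * (dm (2, 0, 0, 0) (phi V) p + dm (0, 2, 0, 0) (phi V) p
        + (dm (0, 0, 0, 1) (phi V) p - 2 * dm (0, 1, 0, 0) (xi2 V) p) * w 0 2)
    + kappa * (dm (4, 0, 0, 0) (phi V) p + 2 * dm (2, 2, 0, 0) (phi V) p + dm (0, 4, 0, 0) (phi V) p)
    + kappa * (6 * dm (0, 2, 0, 1) (phi V) p + 2 * dm (2, 0, 0, 1) (phi V) p
        - 4 * dm (0, 3, 0, 0) (xi2 V) p - 4 * dm (2, 1, 0, 0) (xi2 V) p) * w 0 2
    + kappa * (4 * dm (0, 1, 0, 1) (phi V) p - 6 * dm (0, 2, 0, 0) (xi2 V) p - 2 * dm (2, 0, 0, 0) (xi2 V) p) * w 0 3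
    + (dm (0, 0, 0, 1) (phi V) p - 4 * dm (1, 0, 0, 0) (xi1 V) p) * (kappa * w 4 0)
    + kappa * (3 * dm (0, 0, 0, 2) (phi V) p - 12 * dm (0, 1, 0, 1) (xi2 V) p) * (w 0 2 * w 0 2)
    - kappa * (10 * dm (0, 0, 0, 1) (xi2 V) p) * (w 0 2 * w 0 3)"
  unfolding prolong_Delta1 prolong_coeff_def total_deriv_multi_Delta2[OF assms(1,2) assms(4)[folded assms(3)]]
    characteristic_def spatial_characteristic_def
  using w by (simp add: tau z assms(3) eval_nat_numeral) (simp add: algebra_simps)

text \<open>Once \<open>\<xi>\<^sup>1\<close>, \<open>\<xi>\<^sup>2\<close> are independent of h, \<open>\<phi>\<close> is affine in h and \<open>\<xi>\<^sup>3\<close> depends on t alone, the only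
  nonlinear terms left are the squares and the product of \<open>h\<^sub>x\<close> and \<open>h\<^sub>y\<close>, and \<open>h\<^sub>t\<close> occurs only linearly. The case
  \<open>\<xi>\<^sup>3 = 1\<close> serves the nonclassical equations, a general \<open>\<xi>\<^sup>3\<close> the classical ones.\<close>

lemma prolong_fibre_affine:
  assumes "open \<Omega>" "smooth_vfield \<Omega> V" "jet_pt z = p" "p \<in> \<Omega>"
    and tau: "\<And>i j k l. dm (Suc i, j, k, l) (xi3 V) p = 0"
      "\<And>i j k l. dm (i, Suc j, k, l) (xi3 V) p = 0"
      "\<And>i j k l. dm (i, j, k, Suc l) (xi3 V) p = 0"
    and X: "\<And>i j k l. dm (i, j, k, Suc l) (xi1 V) p = 0"
      "\<And>i j k. dm (i, j, k, 0) (xi1 V) p = X i j k"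
    and Y: "\<And>i j k l. dm (i, j, k, Suc l) (xi2 V) p = 0"
      "\<And>i j k. dm (i, j, k, 0) (xi2 V) p = Y i j k"
    and F: "\<And>i j k l. dm (i, j, k, Suc (Suc l)) (phi V) p = 0"
      "\<And>i j k. dm (i, j, k, Suc 0) (phi V) p = A i j k"
      "\<And>i j k. dm (i, j, k, 0) (phi V) p = F i j k"
    and z: "\<And>a b. z (Dep (a, b, 0)) = w a b"
  shows "prolong 4 V (Delta1 nu kappa lam) z =
    F 0 0 1 + (A 0 0 0 - dm (0, 0, 1, 0) (xi3 V) p) * z (Dep (0, 0, 1))
      - X 0 0 1 * w 1 0 - Y 0 0 1 * w 0 1
    - nu * (F 2 0 0 + F 0 2 0 + 2 * (A 1 0 0 * w 1 0 + A 0 1 0 * w 0 1) + A 0 0 0 * (w 2 0 + w 0 2)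
      - (X 2 0 0 + X 0 2 0) * w 1 0 - (Y 2 0 0 + Y 0 2 0) * w 0 1
      - 2 * (X 1 0 0 * w 2 0 + (X 0 1 0 + Y 1 0 0) * w 1 1 + Y 0 1 0 * w 0 2))
    + kappa * (F 4 0 0 + 2 * F 2 2 0 + F 0 4 0
      + 4 * (A 3 0 0 + A 1 2 0) * w 1 0 + 4 * (A 0 3 0 + A 2 1 0) * w 0 1
      + (6 * A 2 0 0 + 2 * A 0 2 0) * w 2 0 + 8 * A 1 1 0 * w 1 1 + (6 * A 0 2 0 + 2 * A 2 0 0) * w 0 2
      + 4 * A 1 0 0 * (w 3 0 + w 1 2) + 4 * A 0 1 0 * (w 2 1 + w 0 3)
      + A 0 0 0 * (w 4 0 + 2 * w 2 2 + w 0 4))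
    - kappa * ((X 4 0 0 + 2 * X 2 2 0 + X 0 4 0) * w 1 0 + 4 * (X 3 0 0 + X 1 2 0) * w 2 0
      + 4 * (X 0 3 0 + X 2 1 0) * w 1 1 + (6 * X 2 0 0 + 2 * X 0 2 0) * w 3 0 + 8 * X 1 1 0 * w 2 1
      + (6 * X 0 2 0 + 2 * X 2 0 0) * w 1 2 + 4 * X 1 0 0 * (w 4 0 + w 2 2) + 4 * X 0 1 0 * (w 3 1 + w 1 3))
    - kappa * ((Y 4 0 0 + 2 * Y 2 2 0 + Y 0 4 0) * w 0 1 + 4 * (Y 3 0 0 + Y 1 2 0) * w 1 1
      + 4 * (Y 0 3 0 + Y 2 1 0) * w 0 2 + (6 * Y 2 0 0 + 2 * Y 0 2 0) * w 2 1 + 8 * Y 1 1 0 * w 1 2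
      + (6 * Y 0 2 0 + 2 * Y 2 0 0) * w 0 3 + 4 * Y 1 0 0 * (w 3 1 + w 1 3) + 4 * Y 0 1 0 * (w 2 2 + w 0 4))
    - 2 * lam * (w 1 0 * (F 1 0 0 + A 0 0 0 * w 1 0 - X 1 0 0 * w 1 0 - Y 1 0 0 * w 0 1)
      + w 0 1 * (F 0 1 0 + A 0 0 0 * w 0 1 - X 0 1 0 * w 1 0 - Y 0 1 0 * w 0 1))"
  unfolding prolong_Delta1 prolong_coeff_def total_deriv_multi_Delta2[OF assms(1,2) assms(4)[folded assms(3)]]
    characteristic_def spatial_characteristic_def
  by (simp add: tau X Y F z assms(3) eval_nat_numeral) (simp add: algebra_simps)


lemma dm_locally_constant:
  assumes "open S" "smooth_on S g" "\<And>q. q \<in> S \<Longrightarrow> g q = c" "p \<in> S"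
  shows "dm (Suc i, j, k, l) g p = 0" "dm (i, Suc j, k, l) g p = 0"
    "dm (i, j, Suc k, l) g p = 0" "dm (i, j, k, Suc l) g p = 0"
proof -
  have d: "dir v g q = 0" if "q \<in> S" for v q
    using dir_cong[OF assms(1) that, of g "\<lambda>_. c"] assms(3) by simp
  have 1: "dm (1, 0, 0, 0) g q = 0 * dm (0, 0, 0, 0) g q" "dm (0, 1, 0, 0) g q = 0 * dm (0, 0, 0, 0) g q"
    "dm (0, 0, 1, 0) g q = 0 * dm (0, 0, 0, 0) g q" "dm (0, 0, 0, 1) g q = 0 * dm (0, 0, 0, 0) g q" if "q \<in> S" for q
    using d[OF that] by (simp_all add: dm.simps)
  note rel = dm_relation[OF assms(1,2,2) _ assms(4), where c=0 and r="(i, j, k, l)"]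
  show "dm (Suc i, j, k, l) g p = 0" "dm (i, Suc j, k, l) g p = 0"
    "dm (i, j, Suc k, l) g p = 0" "dm (i, j, k, Suc l) g p = 0"
    using rel[OF 1(1)] rel[OF 1(2)] rel[OF 1(3)] rel[OF 1(4)] by simp_all
qed

text \<open>On the invariant surface the derivatives of h in space are restricted by \<open>Delta1 = 0\<close> alone, with \<open>h\<^sub>t\<close>
  eliminated.\<close>

lemma nonclassical_on_jet:
  assumes "open \<Omega>" "nonclassical_symmetry nu kappa lam \<Omega> V" "\<forall>p\<in>\<Omega>. xi3 V p = 1"
    and "p \<in> \<Omega>" "w 0 0 = snd (snd (snd p))"
    and constraint: "phi V p - xi1 V p * w 1 0 - xi2 V p * w 0 1 - nu * (w 2 0 + w 0 2)
      + kappa * (w 4 0 + 2 * w 2 2 + w 0 4) - lam * ((w 1 0)\<^sup>2 + (w 0 1)\<^sup>2) = 0"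
  shows "\<exists>z. jet_pt z = p \<and> (\<forall>a b. z (Dep (a, b, 0)) = w a b)
    \<and> z (Dep (0, 0, 1)) = phi V p - xi1 V p * w 1 0 - xi2 V p * w 0 1
    \<and> prolong 4 V (Delta1 nu kappa lam) z = 0"
proof -
  obtain x y t h where p: "p = (x, y, t, h)" by (cases p)
  have sm: "smooth_vfield \<Omega> V" using assms(2) by (simp add: nonclassical_symmetry_def)
  obtain z where z: "jet_pt z = p" "\<And>a b. z (Dep (a, b, 0)) = w a b"
      "\<forall>J. total_deriv_multi J (Delta2 V) z = 0"
    using exists_jet_on_invariant_surface[OF assms(1) sm assms(3), of x y t w] assms(4,5) p by auto
  have "total_deriv_multi (0, 0, 0) (Delta2 V) z = 0" using z(3) by blast
  then have ht: "z (Dep (0, 0, 1)) = phi V p - xi1 V p * w 1 0 - xi2 V p * w 0 1"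
    using assms(3,4) by (simp add: Delta2_def z(1,2))
  then have "Delta1 nu kappa lam z = 0"
    using constraint by (simp add: Delta1_def z(2))
  then show ?thesis
    using assms(2,4) z ht unfolding nonclassical_symmetry_def by blast
qed

text \<open>Comparison of the coefficients of \<open>h\<^sub>x\<^sub>x h\<^sub>x\<^sub>x\<^sub>x\<close>, \<open>h\<^sub>y\<^sub>y h\<^sub>y\<^sub>y\<^sub>y\<close> and \<open>h\<^sub>x\<^sub>x\<^sup>2\<close>, which the elimination of
  \<open>h\<^sub>y\<^sub>y\<^sub>y\<^sub>y\<close> or \<open>h\<^sub>x\<^sub>x\<^sub>x\<^sub>x\<close> by means of \<open>Delta1 = 0\<close> does not touch. The right-hand side of the third equation
  vanishes by the first one holding on all of \<open>\<Omega>\<close>.\<close>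

lemma nonclassical_h_dependence:
  assumes "open \<Omega>" "nonclassical_symmetry nu kappa lam \<Omega> V" "\<forall>p\<in>\<Omega>. xi3 V p = 1"
    and "kappa \<noteq> 0" "p \<in> \<Omega>"
  shows "dm (0, 0, 0, 1) (xi1 V) p = 0" "dm (0, 0, 0, 1) (xi2 V) p = 0"
    "dm (0, 0, 0, 2) (phi V) p = 4 * dm (1, 0, 0, 1) (xi1 V) p"
proof -
  have sm: "smooth_vfield \<Omega> V" using assms(2) by (simp add: nonclassical_symmetry_def)
  have tau: "dm (Suc i, j, k, l) (xi3 V) p = 0" "dm (i, Suc j, k, l) (xi3 V) p = 0"
    "dm (i, j, Suc k, l) (xi3 V) p = 0" "dm (i, j, k, Suc l) (xi3 V) p = 0" for i j k l
    using dm_locally_constant[OF assms(1) _ assms(3)[rule_format] assms(5)] sm by (auto simp: smooth_vfield_def)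
  let ?h = "snd (snd (snd p))"
  let ?m = "\<lambda>s. (nu * s - phi V p) / kappa"
  have X: "\<exists>c0 c1 c2. \<forall>s r. c0 + c1 * s + c2 * r
      + kappa * (3 * dm (0, 0, 0, 2) (phi V) p - 12 * dm (1, 0, 0, 1) (xi1 V) p) * (s * s)
      - kappa * (10 * dm (0, 0, 0, 1) (xi1 V) p) * (s * r) = 0"
    (is "\<exists>c0 c1 c2. \<forall>s r. ?P c0 c1 c2 s r = 0")
  proof (intro exI allI)
    fix s r
    define w where "w = (\<lambda>a b. if (a, b) = (0, 0) then ?h else if (a, b) = (2, 0) then s
       else if (a, b) = (3, 0) then r else if (a, b) = (0::nat, 4::nat) then ?m s else 0)"
    obtain z where z: "jet_pt z = p" "\<And>a b. z (Dep (a, b, 0)) = w a b"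
      "z (Dep (0, 0, 1)) = phi V p" "prolong 4 V (Delta1 nu kappa lam) z = 0"
      using nonclassical_on_jet[OF assms(1-3,5), of w] assms(4) by (force simp: w_def)
    have K: "kappa * w 0 4 = nu * s - phi V p" using assms(4) by (simp add: w_def)
    note E = prolong_special_jet_x[OF assms(1) sm z(1) assms(5) tau z(2), of nu kappa lam, unfolded K z(3,4)]
    show "?P (dm (0, 0, 1, 0) (phi V) p + dm (0, 0, 0, 1) (phi V) p * phi V p
        - nu * (dm (2, 0, 0, 0) (phi V) p + dm (0, 2, 0, 0) (phi V) p)
        + kappa * (dm (4, 0, 0, 0) (phi V) p + 2 * dm (2, 2, 0, 0) (phi V) p + dm (0, 4, 0, 0) (phi V) p)
        - (dm (0, 0, 0, 1) (phi V) p - 4 * dm (0, 1, 0, 0) (xi2 V) p) * phi V p)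
      (kappa * (6 * dm (2, 0, 0, 1) (phi V) p + 2 * dm (0, 2, 0, 1) (phi V) p
          - 4 * dm (3, 0, 0, 0) (xi1 V) p - 4 * dm (1, 2, 0, 0) (xi1 V) p)
        - nu * (dm (0, 0, 0, 1) (phi V) p - 2 * dm (1, 0, 0, 0) (xi1 V) p)
        + nu * (dm (0, 0, 0, 1) (phi V) p - 4 * dm (0, 1, 0, 0) (xi2 V) p))
      (kappa * (4 * dm (1, 0, 0, 1) (phi V) p - 6 * dm (2, 0, 0, 0) (xi1 V) p - 2 * dm (0, 2, 0, 0) (xi1 V) p)) s r = 0"
      using E by (simp add: w_def algebra_simps)
  qed
  have Y: "\<exists>c0 c1 c2. \<forall>s r. c0 + c1 * s + c2 * r
      + kappa * (3 * dm (0, 0, 0, 2) (phi V) p - 12 * dm (0, 1, 0, 1) (xi2 V) p) * (s * s)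
      - kappa * (10 * dm (0, 0, 0, 1) (xi2 V) p) * (s * r) = 0"
    (is "\<exists>c0 c1 c2. \<forall>s r. ?P c0 c1 c2 s r = 0")
  proof (intro exI allI)
    fix s r
    define w where "w = (\<lambda>a b. if (a, b) = (0, 0) then ?h else if (a, b) = (0, 2) then s
       else if (a, b) = (0, 3) then r else if (a, b) = (4::nat, 0::nat) then ?m s else 0)"
    obtain z where z: "jet_pt z = p" "\<And>a b. z (Dep (a, b, 0)) = w a b"
      "z (Dep (0, 0, 1)) = phi V p" "prolong 4 V (Delta1 nu kappa lam) z = 0"
      using nonclassical_on_jet[OF assms(1-3,5), of w] assms(4) by (force simp: w_def)
    have K: "kappa * w 4 0 = nu * s - phi V p" using assms(4) by (simp add: w_def)
    note E = prolong_special_jet_y[OF assms(1) sm z(1) assms(5) tau z(2), of nu kappa lam, unfolded K z(3,4)]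
    show "?P (dm (0, 0, 1, 0) (phi V) p + dm (0, 0, 0, 1) (phi V) p * phi V p
        - nu * (dm (2, 0, 0, 0) (phi V) p + dm (0, 2, 0, 0) (phi V) p)
        + kappa * (dm (4, 0, 0, 0) (phi V) p + 2 * dm (2, 2, 0, 0) (phi V) p + dm (0, 4, 0, 0) (phi V) p)
        - (dm (0, 0, 0, 1) (phi V) p - 4 * dm (1, 0, 0, 0) (xi1 V) p) * phi V p)
      (kappa * (6 * dm (0, 2, 0, 1) (phi V) p + 2 * dm (2, 0, 0, 1) (phi V) p
          - 4 * dm (0, 3, 0, 0) (xi2 V) p - 4 * dm (2, 1, 0, 0) (xi2 V) p)
        - nu * (dm (0, 0, 0, 1) (phi V) p - 2 * dm (0, 1, 0, 0) (xi2 V) p)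
        + nu * (dm (0, 0, 0, 1) (phi V) p - 4 * dm (1, 0, 0, 0) (xi1 V) p))
      (kappa * (4 * dm (0, 1, 0, 1) (phi V) p - 6 * dm (0, 2, 0, 0) (xi2 V) p - 2 * dm (2, 0, 0, 0) (xi2 V) p)) s r = 0"
      using E by (simp add: w_def algebra_simps)
  qed
  have coeffs: "c = 0 \<and> d = 0"
    if ex: "\<exists>c0 c1 c2. \<forall>s r. c0 + c1 * s + c2 * r + c * (s * s) - d * (s * r) = 0" for c d :: real
  proof -
    obtain c0 c1 c2 where C: "c0 + c1 * s + c2 * r + c * (s * s) - d * (s * r) = 0" for s r
      using ex by blast
    show ?thesis using C[of 0 0] C[of 1 0] C[of "-1" 0] C[of 0 1] C[of 1 1] by auto
  qed
  show "dm (0, 0, 0, 1) (xi1 V) p = 0" "dm (0, 0, 0, 2) (phi V) p = 4 * dm (1, 0, 0, 1) (xi1 V) p"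
    using coeffs[OF X] assms(4) by auto
  show "dm (0, 0, 0, 1) (xi2 V) p = 0"
    using coeffs[OF Y] assms(4) by auto
qed

text \<open>These are, in this order, the coefficients of \<open>h\<^sub>x\<^sub>x\<^sub>x\<^sub>y\<close>, \<open>h\<^sub>x\<^sub>x\<^sub>x\<^sub>x\<close>, \<open>h\<^sub>x\<^sup>2\<close>, \<open>h\<^sub>x\<^sub>x\<^sub>x\<close>, \<open>h\<^sub>y\<^sub>y\<^sub>y\<close>, \<open>h\<^sub>x\<^sub>x\<close>,
  \<open>h\<^sub>x\<close>, \<open>h\<^sub>y\<close> and 1 (up to constant factors and simplified by the preceding ones) in the prolonged action after \<open>h\<^sub>t\<close> is eliminated by \<open>Delta2 = 0\<close> and \<open>h\<^sub>y\<^sub>y\<^sub>y\<^sub>y\<close> by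
  \<open>Delta1 = 0\<close>.\<close>

lemma nonclassical_coefficients:
  assumes "open \<Omega>" "nonclassical_symmetry nu kappa lam \<Omega> V" "\<forall>p\<in>\<Omega>. xi3 V p = 1"
    and "kappa \<noteq> 0" "lam \<noteq> 0" "p \<in> \<Omega>"
  shows "dm (0, 1, 0, 0) (xi1 V) p = - dm (1, 0, 0, 0) (xi2 V) p"
    and "dm (1, 0, 0, 0) (xi1 V) p = dm (0, 1, 0, 0) (xi2 V) p"
    and "dm (0, 0, 0, 1) (phi V) p = - 2 * dm (1, 0, 0, 0) (xi1 V) p"
    and "4 * dm (1, 0, 0, 1) (phi V) p = 6 * dm (2, 0, 0, 0) (xi1 V) p + 2 * dm (0, 2, 0, 0) (xi1 V) p"
    and "4 * dm (0, 1, 0, 1) (phi V) p = 6 * dm (0, 2, 0, 0) (xi2 V) p + 2 * dm (2, 0, 0, 0) (xi2 V) p"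
    and "kappa * (6 * dm (2, 0, 0, 1) (phi V) p + 2 * dm (0, 2, 0, 1) (phi V) p
        - 4 * dm (3, 0, 0, 0) (xi1 V) p - 4 * dm (1, 2, 0, 0) (xi1 V) p)
      = 2 * nu * dm (1, 0, 0, 0) (xi1 V) p"
    and "dm (0, 0, 1, 0) (xi1 V) p + 4 * dm (1, 0, 0, 0) (xi1 V) p * xi1 V p
      + nu * (2 * dm (1, 0, 0, 1) (phi V) p - dm (2, 0, 0, 0) (xi1 V) p - dm (0, 2, 0, 0) (xi1 V) p)
      - kappa * (4 * (dm (3, 0, 0, 1) (phi V) p + dm (1, 2, 0, 1) (phi V) p)
         - (dm (4, 0, 0, 0) (xi1 V) p + 2 * dm (2, 2, 0, 0) (xi1 V) p + dm (0, 4, 0, 0) (xi1 V) p))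
      = - 2 * lam * dm (1, 0, 0, 0) (phi V) p"
    and "dm (0, 0, 1, 0) (xi2 V) p + 4 * dm (1, 0, 0, 0) (xi1 V) p * xi2 V p
      + nu * (2 * dm (0, 1, 0, 1) (phi V) p - dm (2, 0, 0, 0) (xi2 V) p - dm (0, 2, 0, 0) (xi2 V) p)
      - kappa * (4 * (dm (0, 3, 0, 1) (phi V) p + dm (2, 1, 0, 1) (phi V) p)
         - (dm (4, 0, 0, 0) (xi2 V) p + 2 * dm (2, 2, 0, 0) (xi2 V) p + dm (0, 4, 0, 0) (xi2 V) p))
      = - 2 * lam * dm (0, 1, 0, 0) (phi V) p"
    and "dm (0, 0, 1, 0) (phi V) p + 4 * dm (1, 0, 0, 0) (xi1 V) p * phi V p
      - nu * (dm (2, 0, 0, 0) (phi V) p + dm (0, 2, 0, 0) (phi V) p)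
      + kappa * (dm (4, 0, 0, 0) (phi V) p + 2 * dm (2, 2, 0, 0) (phi V) p + dm (0, 4, 0, 0) (phi V) p) = 0"
proof -
  have sm: "smooth_vfield \<Omega> V" using assms(2) by (simp add: nonclassical_symmetry_def)
  then have smi: "smooth_on \<Omega> (xi1 V)" "smooth_on \<Omega> (xi2 V)" "smooth_on \<Omega> (xi3 V)" "smooth_on \<Omega> (phi V)"
    by (auto simp: smooth_vfield_def)
  note tau = dm_locally_constant[OF assms(1) smi(3) assms(3)[rule_format] assms(6)]
  note hd = nonclassical_h_dependence[OF assms(1-4)]
  have X: "dm (i, j, k, Suc l) (xi1 V) q = 0" if "q \<in> \<Omega>" for i j k l q
    using dm_relation[OF assms(1) smi(1,1) _ that, of "(0, 0, 0, 1)" 0 "(0, 0, 0, 1)" "(i, j, k, l)"] hd(1) by simp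
  have Y: "dm (i, j, k, Suc l) (xi2 V) q = 0" if "q \<in> \<Omega>" for i j k l q
    using dm_relation[OF assms(1) smi(2,2) _ that, of "(0, 0, 0, 1)" 0 "(0, 0, 0, 1)" "(i, j, k, l)"] hd(2) by simp
  have F: "dm (i, j, k, Suc (Suc l)) (phi V) q = 0" if "q \<in> \<Omega>" for i j k l q
    using dm_relation[OF assms(1) smi(4,4) _ that, of "(0, 0, 0, 2)" 0 "(0, 0, 0, 2)" "(i, j, k, l)"] hd(3) X
    by (simp add: eval_nat_numeral)
  let ?h = "snd (snd (snd p))"
  let ?X = "\<lambda>i j k. dm (i, j, k, 0) (xi1 V) p" and ?Y = "\<lambda>i j k. dm (i, j, k, 0) (xi2 V) p"
  let ?F = "\<lambda>i j k. dm (i, j, k, 0) (phi V) p" and ?A = "\<lambda>i j k. dm (i, j, k, Suc 0) (phi V) p"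
  let ?K = "\<lambda>w. nu * (w 2 0 + w 0 2) + lam * ((w 1 0)\<^sup>2 + (w 0 1)\<^sup>2)
    - (phi V p - xi1 V p * w 1 0 - xi2 V p * w 0 1) - kappa * (w 4 0 + 2 * w 2 2)"
  \<comment> \<open>the prolonged action as a function of the free space derivatives; \<open>w 0 4\<close> is replaced by its value \<open>?K w / kappa\<close>\<close>
  have P: "?F 0 0 1 + ?A 0 0 0 * (phi V p - xi1 V p * w 1 0 - xi2 V p * w 0 1)
      - ?X 0 0 1 * w 1 0 - ?Y 0 0 1 * w 0 1
    - nu * (?F 2 0 0 + ?F 0 2 0 + 2 * (?A 1 0 0 * w 1 0 + ?A 0 1 0 * w 0 1) + ?A 0 0 0 * (w 2 0 + w 0 2)
      - (?X 2 0 0 + ?X 0 2 0) * w 1 0 - (?Y 2 0 0 + ?Y 0 2 0) * w 0 1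
      - 2 * (?X 1 0 0 * w 2 0 + (?X 0 1 0 + ?Y 1 0 0) * w 1 1 + ?Y 0 1 0 * w 0 2))
    + kappa * (?F 4 0 0 + 2 * ?F 2 2 0 + ?F 0 4 0
      + 4 * (?A 3 0 0 + ?A 1 2 0) * w 1 0 + 4 * (?A 0 3 0 + ?A 2 1 0) * w 0 1
      + (6 * ?A 2 0 0 + 2 * ?A 0 2 0) * w 2 0 + 8 * ?A 1 1 0 * w 1 1 + (6 * ?A 0 2 0 + 2 * ?A 2 0 0) * w 0 2
      + 4 * ?A 1 0 0 * (w 3 0 + w 1 2) + 4 * ?A 0 1 0 * (w 2 1 + w 0 3)
      + ?A 0 0 0 * (w 4 0 + 2 * w 2 2))
    - kappa * ((?X 4 0 0 + 2 * ?X 2 2 0 + ?X 0 4 0) * w 1 0 + 4 * (?X 3 0 0 + ?X 1 2 0) * w 2 0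
      + 4 * (?X 0 3 0 + ?X 2 1 0) * w 1 1 + (6 * ?X 2 0 0 + 2 * ?X 0 2 0) * w 3 0 + 8 * ?X 1 1 0 * w 2 1
      + (6 * ?X 0 2 0 + 2 * ?X 2 0 0) * w 1 2 + 4 * ?X 1 0 0 * (w 4 0 + w 2 2) + 4 * ?X 0 1 0 * (w 3 1 + w 1 3))
    - kappa * ((?Y 4 0 0 + 2 * ?Y 2 2 0 + ?Y 0 4 0) * w 0 1 + 4 * (?Y 3 0 0 + ?Y 1 2 0) * w 1 1
      + 4 * (?Y 0 3 0 + ?Y 2 1 0) * w 0 2 + (6 * ?Y 2 0 0 + 2 * ?Y 0 2 0) * w 2 1 + 8 * ?Y 1 1 0 * w 1 2
      + (6 * ?Y 0 2 0 + 2 * ?Y 2 0 0) * w 0 3 + 4 * ?Y 1 0 0 * (w 3 1 + w 1 3) + 4 * ?Y 0 1 0 * w 2 2)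
    + (?A 0 0 0 - 4 * ?Y 0 1 0) * ?K w
    - 2 * lam * (w 1 0 * (?F 1 0 0 + ?A 0 0 0 * w 1 0 - ?X 1 0 0 * w 1 0 - ?Y 1 0 0 * w 0 1)
      + w 0 1 * (?F 0 1 0 + ?A 0 0 0 * w 0 1 - ?X 0 1 0 * w 1 0 - ?Y 0 1 0 * w 0 1)) = 0"
    if "w 0 0 = ?h" for w :: "nat \<Rightarrow> nat \<Rightarrow> real"
  proof -
    define w' where "w' = (\<lambda>a b. if (a, b) = (0, 4) then ?K w / kappa else w a b)"
    have K: "kappa * w' 0 4 = ?K w" using assms(4) by (simp add: w'_def)
    have w': "w' 1 0 = w 1 0" "w' 0 1 = w 0 1" "w' 2 0 = w 2 0" "w' 1 1 = w 1 1" "w' 0 2 = w 0 2"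
      "w' 3 0 = w 3 0" "w' 2 1 = w 2 1" "w' 1 2 = w 1 2" "w' 0 3 = w 0 3"
      "w' 4 0 = w 4 0" "w' 3 1 = w 3 1" "w' 2 2 = w 2 2" "w' 1 3 = w 1 3" "w' 0 0 = w 0 0"
      by (simp_all add: w'_def)
    have w0: "w' 0 0 = ?h" using that w'(14) by simp
    have cons: "phi V p - xi1 V p * w' 1 0 - xi2 V p * w' 0 1 - nu * (w' 2 0 + w' 0 2)
      + kappa * (w' 4 0 + 2 * w' 2 2 + w' 0 4) - lam * ((w' 1 0)\<^sup>2 + (w' 0 1)\<^sup>2) = 0"
      unfolding distrib_left[of kappa _ "w' 0 4"] K w' by (simp add: algebra_simps)
    obtain z where z: "jet_pt z = p" "\<And>a b. z (Dep (a, b, 0)) = w' a b"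
      "z (Dep (0, 0, 1)) = phi V p - xi1 V p * w' 1 0 - xi2 V p * w' 0 1"
      "prolong 4 V (Delta1 nu kappa lam) z = 0"
      using nonclassical_on_jet[OF assms(1-3,6) w0 cons] by blast
    note E = prolong_fibre_affine[OF assms(1) sm z(1) assms(6) tau(1,2,4) X[OF assms(6)] refl Y[OF assms(6)] refl
        F[OF assms(6)] refl refl z(2), of nu kappa lam, unfolded z(3) w']
    have t0: "dm (0, 0, Suc 0, 0) (xi3 V) p = 0" by (rule tau(3))
    show ?thesis
      unfolding K[symmetric]
      by (rule trans[OF _ z(4)]) (simp only: E, simp add: t0 algebra_simps)
  qed
  \<comment> \<open>jets with a single nonzero derivative of h suffice to separate the coefficients needed\<close>
  define u where "u = (\<lambda>(i::nat) (j::nat) (c::real) a b. if (a, b) = (0, 0) then ?h else if (a, b) = (i, j) then c else 0)"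
  have u0: "u i j c 0 0 = ?h" for i j c by (simp add: u_def)
  note One_nat_def [simp del]
  note Q = P[of "u i j c" for i j c, OF u0, folded One_nat_def]
  have Q0: "?F 0 0 1 + dm (0, 0, 0, 1) (phi V) p * phi V p
    - nu * (?F 2 0 0 + ?F 0 2 0) + kappa * (?F 4 0 0 + 2 * ?F 2 2 0 + ?F 0 4 0)
    - (dm (0, 0, 0, 1) (phi V) p - 4 * ?Y 0 1 0) * phi V p = 0"
    using Q[of 0 0 0] by (simp add: u_def)
  have "kappa * (?X 0 1 0 + ?Y 1 0 0) = 0"
    using Q[of 3 1 1, unfolded u_def, simplified] Q0 by algebra
  then show c1: "dm (0, 1, 0, 0) (xi1 V) p = - dm (1, 0, 0, 0) (xi2 V) p"
    using assms(4) by simp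
  have "kappa * (?X 1 0 0 - ?Y 0 1 0) = 0"
    using Q[of 4 0 1, unfolded u_def, simplified] Q0 by algebra
  then show c2: "dm (1, 0, 0, 0) (xi1 V) p = dm (0, 1, 0, 0) (xi2 V) p"
    using assms(4) by simp
  have "lam * (dm (0, 0, 0, 1) (phi V) p - 4 * ?Y 0 1 0 - 2 * (dm (0, 0, 0, 1) (phi V) p - ?X 1 0 0)) = 0"
    using Q[of 1 0 1, unfolded u_def, simplified] Q[of 1 0 "-1", unfolded u_def, simplified] Q0 by algebra
  then show c3: "dm (0, 0, 0, 1) (phi V) p = - 2 * dm (1, 0, 0, 0) (xi1 V) p"
    using c2 assms(5) by simp
  have "kappa * (4 * dm (1, 0, 0, 1) (phi V) p - (6 * ?X 2 0 0 + 2 * ?X 0 2 0)) = 0"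
    using Q[of 3 0 1, unfolded u_def, simplified] Q0 by algebra
  then show "4 * dm (1, 0, 0, 1) (phi V) p = 6 * dm (2, 0, 0, 0) (xi1 V) p + 2 * dm (0, 2, 0, 0) (xi1 V) p"
    using assms(4) by simp
  have "kappa * (4 * dm (0, 1, 0, 1) (phi V) p - (6 * ?Y 0 2 0 + 2 * ?Y 2 0 0)) = 0"
    using Q[of 0 3 1, unfolded u_def, simplified] Q0 by algebra
  then show "4 * dm (0, 1, 0, 1) (phi V) p = 6 * dm (0, 2, 0, 0) (xi2 V) p + 2 * dm (2, 0, 0, 0) (xi2 V) p"
    using assms(4) by simp
  show "kappa * (6 * dm (2, 0, 0, 1) (phi V) p + 2 * dm (0, 2, 0, 1) (phi V) p
        - 4 * dm (3, 0, 0, 0) (xi1 V) p - 4 * dm (1, 2, 0, 0) (xi1 V) p)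
      = 2 * nu * dm (1, 0, 0, 0) (xi1 V) p"
    using Q[of 2 0 1, unfolded u_def, simplified] Q0 c2 by algebra
  show "dm (0, 0, 1, 0) (xi1 V) p + 4 * dm (1, 0, 0, 0) (xi1 V) p * xi1 V p
      + nu * (2 * dm (1, 0, 0, 1) (phi V) p - dm (2, 0, 0, 0) (xi1 V) p - dm (0, 2, 0, 0) (xi1 V) p)
      - kappa * (4 * (dm (3, 0, 0, 1) (phi V) p + dm (1, 2, 0, 1) (phi V) p)
         - (dm (4, 0, 0, 0) (xi1 V) p + 2 * dm (2, 2, 0, 0) (xi1 V) p + dm (0, 4, 0, 0) (xi1 V) p))
      = - 2 * lam * dm (1, 0, 0, 0) (phi V) p"
    using Q[of 1 0 1, unfolded u_def, simplified] Q[of 1 0 "-1", unfolded u_def, simplified] c2 by algebra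
  show "dm (0, 0, 1, 0) (xi2 V) p + 4 * dm (1, 0, 0, 0) (xi1 V) p * xi2 V p
      + nu * (2 * dm (0, 1, 0, 1) (phi V) p - dm (2, 0, 0, 0) (xi2 V) p - dm (0, 2, 0, 0) (xi2 V) p)
      - kappa * (4 * (dm (0, 3, 0, 1) (phi V) p + dm (2, 1, 0, 1) (phi V) p)
         - (dm (4, 0, 0, 0) (xi2 V) p + 2 * dm (2, 2, 0, 0) (xi2 V) p + dm (0, 4, 0, 0) (xi2 V) p))
      = - 2 * lam * dm (0, 1, 0, 0) (phi V) p"
    using Q[of 0 1 1, unfolded u_def, simplified] Q[of 0 1 "-1", unfolded u_def, simplified] c2 by algebra
  show "dm (0, 0, 1, 0) (phi V) p + 4 * dm (1, 0, 0, 0) (xi1 V) p * phi V p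
      - nu * (dm (2, 0, 0, 0) (phi V) p + dm (0, 2, 0, 0) (phi V) p)
      + kappa * (dm (4, 0, 0, 0) (phi V) p + 2 * dm (2, 2, 0, 0) (phi V) p + dm (0, 4, 0, 0) (phi V) p) = 0"
    using Q0 c2 by algebra
qed

section \<open>The classical equations\<close>

lemma dm_first: "dm (1, 0, 0, 0) g = dir e\<^sub>x g" "dm (0, 1, 0, 0) g = dir e\<^sub>y g"
    "dm (0, 0, 1, 0) g = dir e\<^sub>t g" "dm (0, 0, 0, 1) g = dir e\<^sub>h g"
  by (simp_all add: dm.simps)

lemma dm_Suc:
  assumes "open S" "smooth_on S g" "p \<in> S"
  shows "dir e\<^sub>x (dm (i, j, k, l) g) p = dm (Suc i, j, k, l) g p"
    "dir e\<^sub>y (dm (i, j, k, l) g) p = dm (i, Suc j, k, l) g p"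
    "dir e\<^sub>t (dm (i, j, k, l) g) p = dm (i, j, Suc k, l) g p"
    "dir e\<^sub>h (dm (i, j, k, l) g) p = dm (i, j, k, Suc l) g p"
  using dir_indep_dm[OF assms, of Vx "(i, j, k, l)"] dir_indep_dm[OF assms, of Vy "(i, j, k, l)"]
    dir_indep_dm[OF assms, of Vt "(i, j, k, l)"] dir_h_dm[OF assms, of "(i, j, k, l)"] by simp_all

lemma dm_vanish:
  assumes "open S" "smooth_on S f" "\<And>p. p \<in> S \<Longrightarrow> dm m f p = 0" "p \<in> S"
  shows "dm (pmi_add m r) f p = 0"
  using dm_relation[OF assms(1,2,2) _ assms(4), of m 0 m r] assms(3) by simp

text \<open>The Cauchy-Riemann equations express every second derivative in x and y of u and v through the
  gradient of \<open>u\<^sub>x\<close>.\<close>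

lemma conformal_second_derivatives:
  assumes "open S" "smooth_on S u" "smooth_on S v"
    and CR: "\<And>p. p \<in> S \<Longrightarrow> dm (0, 1, 0, 0) u p = - dm (1, 0, 0, 0) v p"
      "\<And>p. p \<in> S \<Longrightarrow> dm (1, 0, 0, 0) u p = dm (0, 1, 0, 0) v p"
    and a: "\<And>p. p \<in> S \<Longrightarrow> dm (2, 0, 0, 0) u p = 0" "\<And>p. p \<in> S \<Longrightarrow> dm (1, 1, 0, 0) u p = 0"
    and p: "p \<in> S"
  shows "dm (Suc (Suc i), j, k, l) u p = 0" "dm (Suc i, Suc j, k, l) u p = 0" "dm (i, Suc (Suc j), k, l) u p = 0"
    "dm (Suc (Suc i), j, k, l) v p = 0" "dm (Suc i, Suc j, k, l) v p = 0" "dm (i, Suc (Suc j), k, l) v p = 0"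
proof -
  have 1: "dm (pmi_add (0, 1, 0, 0) r) u q = (-1) * dm (pmi_add (1, 0, 0, 0) r) v q" if "q \<in> S" for q r
    using dm_relation[OF assms(1-3) _ that, of "(0, 1, 0, 0)" "-1" "(1, 0, 0, 0)" r] CR(1) by simp
  have 2: "dm (pmi_add (1, 0, 0, 0) r) u q = 1 * dm (pmi_add (0, 1, 0, 0) r) v q" if "q \<in> S" for q r
    using dm_relation[OF assms(1-3) _ that, of "(1, 0, 0, 0)" 1 "(0, 1, 0, 0)" r] CR(2) by simp
  have v2: "dm (2, 0, 0, 0) v q = 0" "dm (1, 1, 0, 0) v q = 0" "dm (0, 2, 0, 0) v q = 0" if "q \<in> S" for q
    using 1[OF that, of "(1, 0, 0, 0)"] 2[OF that, of "(1, 0, 0, 0)"] 2[OF that, of "(0, 1, 0, 0)"] a[OF that]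
    by (simp_all add: numeral_2_eq_2)
  have u2: "dm (0, 2, 0, 0) u q = 0" if "q \<in> S" for q
    using 1[OF that, of "(0, 1, 0, 0)"] v2(2)[OF that] by (simp add: numeral_2_eq_2)
  show "dm (Suc (Suc i), j, k, l) u p = 0" "dm (Suc i, Suc j, k, l) u p = 0" "dm (i, Suc (Suc j), k, l) u p = 0"
    using dm_vanish[OF assms(1,2) a(1) p, of "(i, j, k, l)"] dm_vanish[OF assms(1,2) a(2) p, of "(i, j, k, l)"]
      dm_vanish[OF assms(1,2) u2 p, of "(i, j, k, l)"] by simp_all
  show "dm (Suc (Suc i), j, k, l) v p = 0" "dm (Suc i, Suc j, k, l) v p = 0" "dm (i, Suc (Suc j), k, l) v p = 0"
    using dm_vanish[OF assms(1,3) v2(1) p, of "(i, j, k, l)"] dm_vanish[OF assms(1,3) v2(2) p, of "(i, j, k, l)"]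
      dm_vanish[OF assms(1,3) v2(3) p, of "(i, j, k, l)"] by simp_all
qed

text \<open>For a field of this kind, an infinitesimal similarity whose dilation rate \<open>\<xi>\<^sup>1\<^sub>x\<close> is locally constant, the
  prolonged action multiplies \<open>Delta1\<close> by \<open>-6 \<xi>\<^sup>1\<^sub>x\<close>, except for the viscous term, which scales
  differently and produces the condition on \<open>\<nu>\<close>.\<close>

lemma classical_symmetryI:
  assumes \<Omega>: "open \<Omega>" and sm: "smooth_vfield \<Omega> W" and lam: "lam \<noteq> 0"
    and h: "\<And>p. p \<in> \<Omega> \<Longrightarrow> dm (0, 0, 0, 1) (xi1 W) p = 0" "\<And>p. p \<in> \<Omega> \<Longrightarrow> dm (0, 0, 0, 1) (xi2 W) p = 0"
    and CR: "\<And>p. p \<in> \<Omega> \<Longrightarrow> dm (0, 1, 0, 0) (xi1 W) p = - dm (1, 0, 0, 0) (xi2 W) p"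
      "\<And>p. p \<in> \<Omega> \<Longrightarrow> dm (1, 0, 0, 0) (xi1 W) p = dm (0, 1, 0, 0) (xi2 W) p"
    and a: "\<And>p. p \<in> \<Omega> \<Longrightarrow> dm (2, 0, 0, 0) (xi1 W) p = 0" "\<And>p. p \<in> \<Omega> \<Longrightarrow> dm (1, 1, 0, 0) (xi1 W) p = 0"
      "\<And>p. p \<in> \<Omega> \<Longrightarrow> dm (1, 0, 1, 0) (xi1 W) p = 0"
    and nu: "\<And>p. p \<in> \<Omega> \<Longrightarrow> nu * dm (1, 0, 0, 0) (xi1 W) p = 0"
    and tau: "\<And>p. p \<in> \<Omega> \<Longrightarrow> dm (1, 0, 0, 0) (xi3 W) p = 0" "\<And>p. p \<in> \<Omega> \<Longrightarrow> dm (0, 1, 0, 0) (xi3 W) p = 0"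
      "\<And>p. p \<in> \<Omega> \<Longrightarrow> dm (0, 0, 0, 1) (xi3 W) p = 0"
      "\<And>p. p \<in> \<Omega> \<Longrightarrow> dm (0, 0, 1, 0) (xi3 W) p = 4 * dm (1, 0, 0, 0) (xi1 W) p"
    and phi: "\<And>p. p \<in> \<Omega> \<Longrightarrow> dm (0, 0, 0, 1) (phi W) p = - 2 * dm (1, 0, 0, 0) (xi1 W) p"
      "\<And>p. p \<in> \<Omega> \<Longrightarrow> dm (0, 0, 1, 0) (xi1 W) p = - 2 * lam * dm (1, 0, 0, 0) (phi W) p"
      "\<And>p. p \<in> \<Omega> \<Longrightarrow> dm (0, 0, 1, 0) (xi2 W) p = - 2 * lam * dm (0, 1, 0, 0) (phi W) p"
      "\<And>p. p \<in> \<Omega> \<Longrightarrow> dm (0, 0, 1, 0) (phi W) p = 0"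
  shows "classical_symmetry nu kappa lam \<Omega> W"
  unfolding classical_symmetry_def
proof (intro conjI allI impI sm)
  fix z assume "jet_pt z \<in> \<Omega> \<and> Delta1 nu kappa lam z = 0"
  then have z: "jet_pt z \<in> \<Omega>" and D: "Delta1 nu kappa lam z = 0" by auto
  define p where "p = jet_pt z"
  have p: "p \<in> \<Omega>" using z by (simp add: p_def)
  have smi: "smooth_on \<Omega> (xi1 W)" "smooth_on \<Omega> (xi2 W)" "smooth_on \<Omega> (xi3 W)" "smooth_on \<Omega> (phi W)"
    using sm by (auto simp: smooth_vfield_def)
  note s2 = conformal_second_derivatives[OF \<Omega> smi(1,2) CR a(1,2) p]
  have X: "dm (i, j, k, Suc l) (xi1 W) p = 0" and Y: "dm (i, j, k, Suc l) (xi2 W) p = 0"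
    and T: "dm (Suc i, j, k, l) (xi3 W) p = 0" "dm (i, Suc j, k, l) (xi3 W) p = 0"
      "dm (i, j, k, Suc l) (xi3 W) p = 0" for i j k l
    using dm_vanish[OF \<Omega> smi(1) h(1) p, of "(i, j, k, l)"] dm_vanish[OF \<Omega> smi(2) h(2) p, of "(i, j, k, l)"]
      dm_vanish[OF \<Omega> smi(3) tau(1) p, of "(i, j, k, l)"] dm_vanish[OF \<Omega> smi(3) tau(2) p, of "(i, j, k, l)"]
      dm_vanish[OF \<Omega> smi(3) tau(3) p, of "(i, j, k, l)"] by simp_all
  have A: "dm (i, j, k, Suc l) (phi W) p = - 2 * dm (Suc i, j, k, l) (xi1 W) p" for i j k l
    using dm_relation[OF \<Omega> smi(4,1) phi(1) p, of "(i, j, k, l)"] by simp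
  have A2: "dm (i, j, k, Suc (Suc l)) (phi W) p = 0" for i j k l
    using A[of i j k "Suc l"] X by simp
  have F1: "dm (1, 0, 0, 0) (phi W) q = (- 1 / (2 * lam)) * dm (0, 0, 1, 0) (xi1 W) q"
    "dm (0, 1, 0, 0) (phi W) q = (- 1 / (2 * lam)) * dm (0, 0, 1, 0) (xi2 W) q" if "q \<in> \<Omega>" for q
    using phi(2,3)[OF that] lam by (simp_all add: field_simps)
  have F: "dm (Suc i, j, k, l) (phi W) p = (- 1 / (2 * lam)) * dm (i, j, Suc k, l) (xi1 W) p"
    "dm (i, Suc j, k, l) (phi W) p = (- 1 / (2 * lam)) * dm (i, j, Suc k, l) (xi2 W) p" for i j k l
    using dm_relation[OF \<Omega> smi(4,1) F1(1) p, of "(i, j, k, l)"]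
      dm_relation[OF \<Omega> smi(4,2) F1(2) p, of "(i, j, k, l)"] by simp_all
  have a3: "dm (Suc 0, 0, Suc 0, 0) (xi1 W) p = 0" "dm (0, Suc 0, Suc 0, 0) (xi2 W) p = 0"
    using a(3)[OF p] dm_relation[OF \<Omega> smi(1,2) _ p, of "(1, 0, 0, 0)" 1 "(0, 1, 0, 0)" "(0, 0, 1, 0)"] CR(2)
    by simp_all
  have F2: "dm (2, 0, 0, 0) (phi W) p = 0" "dm (0, 2, 0, 0) (phi W) p = 0" "dm (4, 0, 0, 0) (phi W) p = 0"
    "dm (2, 2, 0, 0) (phi W) p = 0" "dm (0, 4, 0, 0) (phi W) p = 0"
    by (simp_all add: eval_nat_numeral F s2 a3)
  have E: "prolong 4 W (Delta1 nu kappa lam) z =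
      - 6 * dm (1, 0, 0, 0) (xi1 W) p * Delta1 nu kappa lam z
      - 2 * (nu * dm (1, 0, 0, 0) (xi1 W) p) * (z (Dep (2, 0, 0)) + z (Dep (0, 2, 0)))"
    unfolding prolong_fibre_affine[OF \<Omega> sm p_def[symmetric] p T X refl Y refl A2 refl refl, where w="\<lambda>a b. z (Dep (a, b, 0))", OF refl]
    unfolding Delta1_def F2 phi(2)[OF p] phi(3)[OF p] phi(4)[OF p] tau(4)[OF p] CR(1)[OF p] CR(2)[OF p, symmetric]
    by (simp add: A s2 eval_nat_numeral) (simp add: algebra_simps power2_eq_square)
  then show "prolong 4 W (Delta1 nu kappa lam) z = 0"
    using D nu[OF p] by simp
qed

section \<open>Integrability conditions and the Riccati equation\<close>

text \<open>Since \<open>\<phi>\<^sub>h = -2a\<close>, the third order coefficients read \<open>-8 a\<^sub>x = 4 a\<^sub>x\<close> and \<open>-8 a\<^sub>y = 4 a\<^sub>y\<close>, so a depends on t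
  alone and all higher derivatives of \<open>\<xi>\<^sup>1\<close>, \<open>\<xi>\<^sup>2\<close> in space drop out. The derivative of the last coefficient
  in h is \<open>-2 (a\<^sub>t + 4a\<^sup>2)\<close>; with this, differentiating the coefficients of \<open>h\<^sub>x\<close>, \<open>h\<^sub>y\<close> in x, y gives
  \<open>\<phi>\<^sub>x\<^sub>x = \<phi>\<^sub>y\<^sub>y = 0\<close>.\<close>

lemma nonclassical_equations:
  assumes \<Omega>: "open \<Omega>" and V: "nonclassical_symmetry nu kappa lam \<Omega> V" and xi3: "\<forall>p\<in>\<Omega>. xi3 V p = 1"
    and kappa: "kappa \<noteq> 0" and lam: "lam \<noteq> 0" and p: "p \<in> \<Omega>"
  shows "dm (2, 0, 0, 0) (xi1 V) p = 0" "dm (1, 1, 0, 0) (xi1 V) p = 0"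
    and "nu * dm (1, 0, 0, 0) (xi1 V) p = 0"
    and "dm (1, 0, 1, 0) (xi1 V) p = - 4 * (dm (1, 0, 0, 0) (xi1 V) p)\<^sup>2"
    and "dm (0, 0, 1, 0) (xi1 V) p + 4 * dm (1, 0, 0, 0) (xi1 V) p * xi1 V p = - 2 * lam * dm (1, 0, 0, 0) (phi V) p"
    and "dm (0, 0, 1, 0) (xi2 V) p + 4 * dm (1, 0, 0, 0) (xi1 V) p * xi2 V p = - 2 * lam * dm (0, 1, 0, 0) (phi V) p"
    and "dm (0, 0, 1, 0) (phi V) p + 4 * dm (1, 0, 0, 0) (xi1 V) p * phi V p = 0"
proof -
  let ?a = "dm (1, 0, 0, 0) (xi1 V)"
  have smi: "smooth_on \<Omega> (xi1 V)" "smooth_on \<Omega> (xi2 V)" "smooth_on \<Omega> (phi V)"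
    using V by (auto simp: nonclassical_symmetry_def smooth_vfield_def)
  note C = nonclassical_coefficients[OF \<Omega> V xi3 kappa lam]
  have h: "dm (i, j, k, Suc l) (xi1 V) q = 0" if "q \<in> \<Omega>" for i j k l q
    using dm_vanish[OF \<Omega> smi(1) nonclassical_h_dependence(1)[OF \<Omega> V xi3 kappa] that, of "(i, j, k, l)"] by simp
  have A: "dm (i, j, k, Suc l) (phi V) q = - 2 * dm (Suc i, j, k, l) (xi1 V) q" if "q \<in> \<Omega>" for i j k l q
    using dm_relation[OF \<Omega> smi(3,1) C(3) that, of "(i, j, k, l)"] by simp
  have second: "dm (2, 0, 0, 0) (xi1 V) q = 0 \<and> dm (1, 1, 0, 0) (xi1 V) q = 0" if "q \<in> \<Omega>" for q
  proof -
    have CR1: "dm (pmi_add (0, 1, 0, 0) r) (xi1 V) q = (-1) * dm (pmi_add (1, 0, 0, 0) r) (xi2 V) q" for r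
      using dm_relation[OF \<Omega> smi(1,2) _ that, of "(0, 1, 0, 0)" "-1" "(1, 0, 0, 0)" r] C(1) by simp
    have CR2: "dm (pmi_add (1, 0, 0, 0) r) (xi1 V) q = 1 * dm (pmi_add (0, 1, 0, 0) r) (xi2 V) q" for r
      using dm_relation[OF \<Omega> smi(1,2) _ that, of "(1, 0, 0, 0)" 1 "(0, 1, 0, 0)" r] C(2) by simp
    show ?thesis
      using CR1[of "(1, 0, 0, 0)"] CR1[of "(0, 1, 0, 0)"] CR2[of "(1, 0, 0, 0)"] CR2[of "(0, 1, 0, 0)"]
        C(4)[OF that] C(5)[OF that] A[OF that, of 1 0 0 0] A[OF that, of 0 1 0 0]
      by (simp add: numeral_2_eq_2)
  qed
  have s2: "dm (Suc (Suc i), j, k, l) (xi1 V) q = 0" "dm (Suc i, Suc j, k, l) (xi1 V) q = 0"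
    "dm (i, Suc (Suc j), k, l) (xi1 V) q = 0" "dm (Suc (Suc i), j, k, l) (xi2 V) q = 0"
    "dm (Suc i, Suc j, k, l) (xi2 V) q = 0" "dm (i, Suc (Suc j), k, l) (xi2 V) q = 0" if "q \<in> \<Omega>" for i j k l q
    using conformal_second_derivatives[OF \<Omega> smi(1,2) C(1,2) conjunct1[OF second] conjunct2[OF second] that]
    by auto
  show "dm (2, 0, 0, 0) (xi1 V) p = 0" "dm (1, 1, 0, 0) (xi1 V) p = 0" using second[OF p] by auto
  show "nu * ?a p = 0"
    using C(6)[OF p] A[OF p] s2[OF p] by (simp add: eval_nat_numeral)
  have E1: "dm (0, 0, 1, 0) (xi1 V) q + 4 * ?a q * xi1 V q = - 2 * lam * dm (1, 0, 0, 0) (phi V) q"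
    if "q \<in> \<Omega>" for q
    using C(7)[OF that] A[OF that] s2[OF that] by (simp add: eval_nat_numeral)
  have E2: "dm (0, 0, 1, 0) (xi2 V) q + 4 * ?a q * xi2 V q = - 2 * lam * dm (0, 1, 0, 0) (phi V) q"
    if "q \<in> \<Omega>" for q
    using C(8)[OF that] A[OF that] s2[OF that] by (simp add: eval_nat_numeral)
  note d = smi[THEN smooth_on_dm, THEN smooth_on_has_derivative]
  have riccati: "dm (1, 0, 1, 0) (xi1 V) q = - 4 * (?a q)\<^sup>2" if q: "q \<in> \<Omega>" for q
  proof -
    let ?G = "\<lambda>q. dm (0, 0, 1, 0) (phi V) q + 4 * ?a q * phi V q
      - nu * (dm (2, 0, 0, 0) (phi V) q + dm (0, 2, 0, 0) (phi V) q)
      + kappa * (dm (4, 0, 0, 0) (phi V) q + 2 * dm (2, 2, 0, 0) (phi V) q + dm (0, 4, 0, 0) (phi V) q)"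
    have D: "(?G has_derivative (\<lambda>v. dir v (dm (0, 0, 1, 0) (phi V)) q
      + (4 * ?a q * dir v (phi V) q + 4 * dir v ?a q * phi V q)
      - nu * (dir v (dm (2, 0, 0, 0) (phi V)) q + dir v (dm (0, 2, 0, 0) (phi V)) q)
      + kappa * (dir v (dm (4, 0, 0, 0) (phi V)) q + 2 * dir v (dm (2, 2, 0, 0) (phi V)) q
          + dir v (dm (0, 4, 0, 0) (phi V)) q))) (at q)"
      by (intro has_derivative_add has_derivative_diff has_derivative_mult_right has_derivative_mult
          d[OF q] smooth_on_has_derivative[OF smi(3) q])
    have "dir e\<^sub>h ?G q = 0"
      using dir_cong[OF \<Omega> q, of ?G "\<lambda>_. 0" e\<^sub>h] C(9) by simp
    from this[unfolded dir_eqI[OF D]] show ?thesis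
      using A[OF q] h[OF q] s2[OF q] dm_Suc(4)[OF \<Omega> smi(3) q, of 0 0 0 0]
      by (simp add: eval_nat_numeral dm_Suc(4)[OF \<Omega> smi(3) q] dm_Suc(4)[OF \<Omega> smi(1) q] power2_eq_square)
  qed
  have F: "dm (2, 0, 0, 0) (phi V) q = 0" "dm (0, 2, 0, 0) (phi V) q = 0" if q: "q \<in> \<Omega>" for q
  proof -
    have D1: "((\<lambda>q. dm (0, 0, 1, 0) (xi1 V) q + 4 * ?a q * xi1 V q) has_derivative
      (\<lambda>v. dir v (dm (0, 0, 1, 0) (xi1 V)) q + (4 * ?a q * dir v (xi1 V) q + 4 * dir v ?a q * xi1 V q))) (at q)"
      by (intro has_derivative_add has_derivative_mult_right has_derivative_mult
          d[OF q] smooth_on_has_derivative[OF smi(1) q])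
    have D2: "((\<lambda>q. dm (0, 0, 1, 0) (xi2 V) q + 4 * ?a q * xi2 V q) has_derivative
      (\<lambda>v. dir v (dm (0, 0, 1, 0) (xi2 V)) q + (4 * ?a q * dir v (xi2 V) q + 4 * dir v ?a q * xi2 V q))) (at q)"
      by (intro has_derivative_add has_derivative_mult_right has_derivative_mult
          d[OF q] smooth_on_has_derivative[OF smi(2) q])
    have t: "dm (0, 1, 1, 0) (xi2 V) q = dm (1, 0, 1, 0) (xi1 V) q"
      using dm_relation[OF \<Omega> smi(1,2) _ q, of "(1, 0, 0, 0)" 1 "(0, 1, 0, 0)" "(0, 0, 1, 0)"] C(2) by simp
    have "dir e\<^sub>x (dm (0, 0, 1, 0) (xi1 V)) q + (4 * ?a q * dir e\<^sub>x (xi1 V) q + 4 * dir e\<^sub>x ?a q * xi1 V q)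
        = (- 2 * lam) * dir e\<^sub>x (dm (1, 0, 0, 0) (phi V)) q"
      unfolding dir_eqI[OF D1, symmetric] dir_cmult[OF smooth_on_dm[OF smi(3)] q, symmetric]
      by (rule dir_cong[OF \<Omega> q E1])
    then show "dm (2, 0, 0, 0) (phi V) q = 0"
      using lam riccati[OF q] s2[OF q] dm_Suc(1)[OF \<Omega> smi(1) q, of 0 0 0 0]
      by (simp add: dm_Suc[OF \<Omega> smi(1) q] dm_Suc[OF \<Omega> smi(3) q] numeral_2_eq_2 power2_eq_square)
    have "dir e\<^sub>y (dm (0, 0, 1, 0) (xi2 V)) q + (4 * ?a q * dir e\<^sub>y (xi2 V) q + 4 * dir e\<^sub>y ?a q * xi2 V q)
        = (- 2 * lam) * dir e\<^sub>y (dm (0, 1, 0, 0) (phi V)) q"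
      unfolding dir_eqI[OF D2, symmetric] dir_cmult[OF smooth_on_dm[OF smi(3)] q, symmetric]
      by (rule dir_cong[OF \<Omega> q E2])
    then show "dm (0, 2, 0, 0) (phi V) q = 0"
      using lam riccati[OF q] s2[OF q] C(2)[OF q] t dm_Suc(2)[OF \<Omega> smi(2) q, of 0 0 0 0]
      by (simp add: dm_Suc[OF \<Omega> smi(1) q] dm_Suc[OF \<Omega> smi(2) q] dm_Suc[OF \<Omega> smi(3) q]
          numeral_2_eq_2 power2_eq_square)
  qed
  show "dm (1, 0, 1, 0) (xi1 V) p = - 4 * (?a p)\<^sup>2" by (rule riccati[OF p])
  show "dm (0, 0, 1, 0) (xi1 V) p + 4 * ?a p * xi1 V p = - 2 * lam * dm (1, 0, 0, 0) (phi V) p" by (rule E1[OF p])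
  show "dm (0, 0, 1, 0) (xi2 V) p + 4 * ?a p * xi2 V p = - 2 * lam * dm (0, 1, 0, 0) (phi V) p" by (rule E2[OF p])
  have "dm (4, 0, 0, 0) (phi V) p = 0" "dm (2, 2, 0, 0) (phi V) p = 0" "dm (0, 4, 0, 0) (phi V) p = 0"
    using dm_vanish[OF \<Omega> smi(3) F(1) p, of "(2, 0, 0, 0)"] dm_vanish[OF \<Omega> smi(3) F(1) p, of "(0, 2, 0, 0)"]
      dm_vanish[OF \<Omega> smi(3) F(2) p, of "(0, 2, 0, 0)"] by (simp_all add: eval_nat_numeral)
  then show "dm (0, 0, 1, 0) (phi V) p + 4 * ?a p * phi V p = 0"
    using C(9)[OF p] F[OF p] by simp
qed

text \<open>Along a segment the restriction of a solves \<open>b' = c b\<^sup>2\<close>, a linear equation with the continuous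
  coefficient c b, so one zero forces it to vanish on the whole segment.\<close>

lemma riccati_zero_set_open:
  fixes a :: "'a::real_normed_vector \<Rightarrow> real"
  assumes "open S" "smooth_on S a" "\<And>v p. p \<in> S \<Longrightarrow> dir v a p = k v * (a p)\<^sup>2"
  shows "open {p \<in> S. a p = 0}"
  unfolding open_contains_ball
proof
  fix p assume "p \<in> {p \<in> S. a p = 0}"
  then have p: "p \<in> S" "a p = 0" by auto
  obtain r where r: "r > 0" "ball p r \<subseteq> S" using assms(1) p(1) by (meson open_contains_ball)
  have "a q = 0" if q: "q \<in> ball p r" for q
  proof -
    define v where "v = q - p"
    define b where "b = (\<lambda>s. a (p + s *\<^sub>R v))"
    have seg: "p + s *\<^sub>R v \<in> S" if "s \<in> {0..1}" for s
    proof -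
      have "norm (s *\<^sub>R v) \<le> norm v" using that by (simp add: mult_left_le_one_le)
      also have "\<dots> < r" using q by (simp add: v_def dist_norm norm_minus_commute)
      finally show ?thesis using r(2) by (auto simp: dist_norm subset_iff)
    qed
    have b': "(b has_real_derivative k v * (b s)\<^sup>2) (at s)" if "s \<in> {0..1}" for s
      using smooth_line_derivative[OF assms(2) seg[OF that]] assms(3)[OF seg[OF that]] by (simp add: b_def)
    then have "continuous_on {0..1} b"
      by (meson DERIV_isCont continuous_at_imp_continuous_on)
    then obtain B where B: "\<And>s. s \<in> {0..1} \<Longrightarrow> (B has_vector_derivative b s) (at s within {0..1})"
      using antiderivative_continuous by blast
    have "((\<lambda>s. b s * exp (- k v * B s)) has_real_derivative 0) (at s within {0..1})" if s: "s \<in> {0..1}" for s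
      using DERIV_subset[OF b'[OF s], of "{0..1}"] B[OF s]
      by (auto intro!: derivative_eq_intros simp: has_real_derivative_iff_has_vector_derivative[symmetric]
          power2_eq_square)
    then obtain c where c: "\<And>s. s \<in> {0..1} \<Longrightarrow> b s * exp (- k v * B s) = c"
      using has_field_derivative_zero_constant[of "{0..1::real}" "\<lambda>s. b s * exp (- k v * B s)"] by auto
    have "b 0 = 0" using p(2) by (simp add: b_def)
    then have "b 1 = 0" using c[of 0] c[of 1] by simp
    then show "a q = 0" by (simp add: b_def v_def)
  qed
  then show "\<exists>e>0. ball p e \<subseteq> {p \<in> S. a p = 0}" using r by blast
qed

text \<open>Where a is nonzero it satisfies the equation required of f itself; where it vanishes the equation
  says that f is locally constant. As both sets are open, f can be chosen separately on each, without any
  assumption on the shape of the domain.\<close>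

lemma riccati_integrating_factor:
  fixes a :: "'a::real_normed_vector \<Rightarrow> real"
  assumes S: "open S" and a: "smooth_on S a" "\<And>v p. p \<in> S \<Longrightarrow> dir v a p = k v * (a p)\<^sup>2"
  shows "\<exists>f. smooth_on S f \<and> (\<forall>p\<in>S. f p \<noteq> 0) \<and> (\<forall>p\<in>S. \<forall>v. dir v f p = k v * a p * f p)"
proof -
  define f where "f = (\<lambda>p. if a p = 0 then 1 else a p)"
  let ?S0 = "{p \<in> S. a p = 0}" and ?S1 = "{p \<in> S. a p \<noteq> 0}"
  have S0: "open ?S0" by (rule riccati_zero_set_open[OF S a])
  have S1: "open ?S1"
    using continuous_open_preimage[OF smooth_on_continuous[OF a(1)] S, of "- {0}"]
    by (simp add: vimage_def Int_def open_Compl)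
  have "smooth_on ?S0 f"
    by (rule smooth_on_cong[OF S0 _ smooth_on_const[of _ 1]]) (simp add: f_def)
  moreover have "smooth_on ?S1 f"
    by (rule smooth_on_cong[OF S1 _ smooth_on_subset[OF _ a(1)]]) (auto simp: f_def)
  ultimately have "smooth_on (?S0 \<union> ?S1) f" by (rule smooth_on_Un[OF S0 S1])
  moreover have "?S0 \<union> ?S1 = S" by auto
  moreover have "dir v f p = k v * a p * f p" if p: "p \<in> S" for v p
  proof (cases "a p = 0")
    case True
    then have "dir v f p = dir v (\<lambda>_. 1) p"
      using p by (intro dir_cong[OF S0]) (auto simp: f_def)
    then show ?thesis using True by simp
  next
    case False
    then have "dir v f p = dir v a p"
      using p by (intro dir_cong[OF S1]) (auto simp: f_def)
    then show ?thesis using False a(2)[OF p] by (simp add: f_def power2_eq_square)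
  qed
  ultimately show ?thesis by (intro exI[of _ f]) (auto simp: f_def)
qed

section \<open>Nonclassical symmetries are multiples of classical ones\<close>

text \<open>Dividing by f with \<open>f\<^sub>t = -4af\<close> adds \<open>4a\<close> times each coefficient to its derivative in t. This absorbs
  exactly the terms by which the nonclassical equations differ from the classical ones, turns \<open>\<xi>\<^sup>3\<close> into
  1/f with \<open>(1/f)\<^sub>t = 4a/f\<close>, and makes the dilation rate a/f locally constant.\<close>

lemma normalized_nonclassical_is_multiple_of_classical:
  assumes \<Omega>: "open \<Omega>" and V: "nonclassical_symmetry nu kappa lam \<Omega> V" and xi3: "\<forall>p\<in>\<Omega>. xi3 V p = 1"
    and kappa: "kappa \<noteq> 0" and lam: "lam \<noteq> 0"
  shows "\<exists>f W. smooth_on \<Omega> f \<and> (\<forall>p\<in>\<Omega>. f p \<noteq> 0) \<and> classical_symmetry nu kappa lam \<Omega> W \<and> multiple_on \<Omega> f W V"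
proof -
  define a where "a = dm (1, 0, 0, 0) (xi1 V)"
  \<comment> \<open>the differential of a is \<open>a\<^sup>2 k\<close> with \<open>k = -4 dt\<close>\<close>
  define k :: "pt \<Rightarrow> real" where "k = (\<lambda>v. - 4 * fst (snd (snd v)))"
  have k: "k e\<^sub>x = 0" "k e\<^sub>y = 0" "k e\<^sub>t = - 4" "k e\<^sub>h = 0"
    by (simp_all add: k_def e\<^sub>x_def e\<^sub>y_def e\<^sub>t_def e\<^sub>h_def)
  have smi: "smooth_on \<Omega> (xi1 V)" "smooth_on \<Omega> (xi2 V)" "smooth_on \<Omega> (xi3 V)" "smooth_on \<Omega> (phi V)"
    using V by (auto simp: nonclassical_symmetry_def smooth_vfield_def)
  have sma: "smooth_on \<Omega> a" unfolding a_def by (rule smooth_on_dm[OF smi(1)])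
  note C = nonclassical_coefficients[OF \<Omega> V xi3 kappa lam]
  note N = nonclassical_equations[OF \<Omega> V xi3 kappa lam]
  have h: "dm (0, 0, 0, 1) (xi1 V) q = 0" "dm (0, 0, 0, 1) (xi2 V) q = 0" if "q \<in> \<Omega>" for q
    using nonclassical_h_dependence[OF \<Omega> V xi3 kappa that] by auto
  have dira: "dir v a p = k v * (a p)\<^sup>2" if p: "p \<in> \<Omega>" for v p
  proof -
    have lin: "linear (\<lambda>v. dir v a p)"
      using smooth_on_has_derivative[OF sma p] has_derivative_linear by blast
    obtain v1 v2 v3 v4 where v: "v = (v1, v2, v3, v4)" by (cases v)
    have "v = v1 *\<^sub>R e\<^sub>x + (v2 *\<^sub>R e\<^sub>y + (v3 *\<^sub>R e\<^sub>t + v4 *\<^sub>R e\<^sub>h))"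
      by (simp add: v e\<^sub>x_def e\<^sub>y_def e\<^sub>t_def e\<^sub>h_def)
    then have "dir v a p = v1 * dir e\<^sub>x a p + (v2 * dir e\<^sub>y a p + (v3 * dir e\<^sub>t a p + v4 * dir e\<^sub>h a p))"
      by (simp add: linear_add[OF lin] linear_scale[OF lin])
    also have "dir e\<^sub>x a p = 0"
      using N(1)[OF p] by (simp add: a_def dm_Suc[OF \<Omega> smi(1) p] numeral_2_eq_2)
    also have "dir e\<^sub>y a p = 0"
      using N(2)[OF p] by (simp add: a_def dm_Suc[OF \<Omega> smi(1) p])
    also have "dir e\<^sub>t a p = - 4 * (a p)\<^sup>2"
      using N(4)[OF p] by (simp add: a_def dm_Suc[OF \<Omega> smi(1) p])
    also have "dir e\<^sub>h a p = 0"
      using dm_vanish[OF \<Omega> smi(1) h(1) p, of "(1, 0, 0, 0)"] by (simp add: a_def dm_Suc[OF \<Omega> smi(1) p])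
    finally show ?thesis by (simp add: v k_def)
  qed
  obtain f where smf: "smooth_on \<Omega> f" and f0: "\<And>p. p \<in> \<Omega> \<Longrightarrow> f p \<noteq> 0"
    and dirf: "\<And>p v. p \<in> \<Omega> \<Longrightarrow> dir v f p = k v * a p * f p"
    using riccati_integrating_factor[OF \<Omega> sma dira] by blast
  have smq: "smooth_on \<Omega> (\<lambda>p. g p / f p)" if "smooth_on \<Omega> g" for g
    by (rule smooth_on_divide[OF \<Omega> that smf f0])
  have dirq: "dir v (\<lambda>p. g p / f p) p = (dir v g p - k v * a p * g p) / f p"
    if "smooth_on \<Omega> g" "p \<in> \<Omega>" for g v p
  proof -
    have "dir v (\<lambda>p. g p / f p) p = (dir v g p * f p - g p * (k v * a p * f p)) / (f p * f p)"
      using dir_divide[OF that(1) smf that(2) f0[OF that(2)]] dirf[OF that(2)] by simp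
    also have "\<dots> = (f p * (dir v g p - k v * a p * g p)) / (f p * f p)"
      by (simp add: algebra_simps)
    finally show ?thesis using f0[OF that(2)] by simp
  qed
  define W where "W = \<lparr>xi1 = \<lambda>p. xi1 V p / f p, xi2 = \<lambda>p. xi2 V p / f p,
      xi3 = \<lambda>p. xi3 V p / f p, phi = \<lambda>p. phi V p / f p\<rparr>"
  have smW: "smooth_vfield \<Omega> W"
    using smi smq by (simp add: W_def smooth_vfield_def)
  have first: "dm (1, 0, 0, 0) (\<lambda>p. g p / f p) q = dm (1, 0, 0, 0) g q / f q"
    "dm (0, 1, 0, 0) (\<lambda>p. g p / f p) q = dm (0, 1, 0, 0) g q / f q"
    "dm (0, 0, 1, 0) (\<lambda>p. g p / f p) q = (dm (0, 0, 1, 0) g q + 4 * a q * g q) / f q"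
    "dm (0, 0, 0, 1) (\<lambda>p. g p / f p) q = dm (0, 0, 0, 1) g q / f q" if "smooth_on \<Omega> g" "q \<in> \<Omega>" for g q
    unfolding dm_first dirq[OF that] k by simp_all
  have second: "dm (2, 0, 0, 0) (xi1 W) q = 0" "dm (1, 1, 0, 0) (xi1 W) q = 0"
    "dm (1, 0, 1, 0) (xi1 W) q = 0" if q: "q \<in> \<Omega>" for q
  proof -
    have "dir v (dm (1, 0, 0, 0) (xi1 W)) q = dir v (\<lambda>p. a p / f p) q" for v
      by (rule dir_cong[OF \<Omega> q]) (use first(1)[OF smi(1)] in \<open>simp add: W_def a_def\<close>)
    then have "dir v (dm (1, 0, 0, 0) (xi1 W)) q = 0" for v
      using dirq[OF sma q] dira[OF q] by (simp add: power2_eq_square)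
    then show "dm (2, 0, 0, 0) (xi1 W) q = 0" "dm (1, 1, 0, 0) (xi1 W) q = 0"
      "dm (1, 0, 1, 0) (xi1 W) q = 0"
      using dm_Suc[OF \<Omega> _ q, of "xi1 W" 1 0 0 0] smW by (simp_all add: smooth_vfield_def numeral_2_eq_2)
  qed
  have t: "dm (1, 0, 0, 0) (xi3 V) q = 0" "dm (0, 1, 0, 0) (xi3 V) q = 0" "dm (0, 0, 1, 0) (xi3 V) q = 0"
    "dm (0, 0, 0, 1) (xi3 V) q = 0" if "q \<in> \<Omega>" for q
    using dm_locally_constant[OF \<Omega> smi(3) _ that, of 1 0 0 0 0] xi3 by simp_all
  have "classical_symmetry nu kappa lam \<Omega> W"
  proof (rule classical_symmetryI[OF \<Omega> smW lam _ _ _ _ second])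
    fix q assume q: "q \<in> \<Omega>"
    note simps = W_def first[OF smi(1) q] first[OF smi(2) q] first[OF smi(3) q] first[OF smi(4) q]
    show "dm (0, 0, 0, 1) (xi1 W) q = 0" "dm (0, 0, 0, 1) (xi2 W) q = 0"
      using h[OF q] by (simp_all add: simps del: One_nat_def)
    show "dm (0, 1, 0, 0) (xi1 W) q = - dm (1, 0, 0, 0) (xi2 W) q"
      "dm (1, 0, 0, 0) (xi1 W) q = dm (0, 1, 0, 0) (xi2 W) q"
      "dm (0, 0, 0, 1) (phi W) q = - 2 * dm (1, 0, 0, 0) (xi1 W) q"
      using C(1-3)[OF q] by (simp_all add: simps del: One_nat_def)
    show "nu * dm (1, 0, 0, 0) (xi1 W) q = 0"
      using N(3)[OF q] by (simp add: simps del: One_nat_def)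
    show "dm (1, 0, 0, 0) (xi3 W) q = 0" "dm (0, 1, 0, 0) (xi3 W) q = 0" "dm (0, 0, 0, 1) (xi3 W) q = 0"
      "dm (0, 0, 1, 0) (xi3 W) q = 4 * dm (1, 0, 0, 0) (xi1 W) q"
      using t[OF q] xi3 q by (simp_all add: simps a_def del: One_nat_def)
    show "dm (0, 0, 1, 0) (xi1 W) q = - 2 * lam * dm (1, 0, 0, 0) (phi W) q"
      "dm (0, 0, 1, 0) (xi2 W) q = - 2 * lam * dm (0, 1, 0, 0) (phi W) q"
      "dm (0, 0, 1, 0) (phi W) q = 0"
      using N(5-7)[OF q] by (simp_all add: simps a_def del: One_nat_def)
  qed
  moreover have "multiple_on \<Omega> f W V"
    using f0 by (simp add: multiple_on_def W_def)
  ultimately show ?thesis using smf f0 by blast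
qed

text \<open>Here \<open>\<nu>a = 0\<close> gives a = 0, and the determining equations coincide without rescaling.\<close>

lemma nonclassical_is_classical:
  assumes \<Omega>: "open \<Omega>" and V: "nonclassical_symmetry nu kappa lam \<Omega> V" and xi3: "\<forall>p\<in>\<Omega>. xi3 V p = 1"
    and kappa: "kappa \<noteq> 0" and lam: "lam \<noteq> 0" and nu: "nu \<noteq> 0"
  shows "classical_symmetry nu kappa lam \<Omega> V"
proof -
  have sm: "smooth_vfield \<Omega> V" using V by (simp add: nonclassical_symmetry_def)
  then have smi: "smooth_on \<Omega> (xi1 V)" "smooth_on \<Omega> (xi3 V)" by (auto simp: smooth_vfield_def)
  note C = nonclassical_coefficients[OF \<Omega> V xi3 kappa lam]
  note N = nonclassical_equations[OF \<Omega> V xi3 kappa lam]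
  have a: "dm (1, 0, 0, 0) (xi1 V) q = 0" if "q \<in> \<Omega>" for q
    using N(3)[OF that] nu by simp
  show ?thesis
  proof (rule classical_symmetryI[OF \<Omega> sm lam])
    fix q assume q: "q \<in> \<Omega>"
    show "dm (0, 0, 0, 1) (xi1 V) q = 0" "dm (0, 0, 0, 1) (xi2 V) q = 0"
      by (rule nonclassical_h_dependence[OF \<Omega> V xi3 kappa q])+
    show "dm (0, 1, 0, 0) (xi1 V) q = - dm (1, 0, 0, 0) (xi2 V) q"
      "dm (1, 0, 0, 0) (xi1 V) q = dm (0, 1, 0, 0) (xi2 V) q"
      "dm (0, 0, 0, 1) (phi V) q = - 2 * dm (1, 0, 0, 0) (xi1 V) q"
      by (rule C[OF q])+
    show "dm (2, 0, 0, 0) (xi1 V) q = 0" "dm (1, 1, 0, 0) (xi1 V) q = 0"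
      "nu * dm (1, 0, 0, 0) (xi1 V) q = 0"
      by (rule N[OF q])+
    show "dm (1, 0, 1, 0) (xi1 V) q = 0"
      using N(4)[OF q] a[OF q] by simp
    show "dm (1, 0, 0, 0) (xi3 V) q = 0" "dm (0, 1, 0, 0) (xi3 V) q = 0" "dm (0, 0, 0, 1) (xi3 V) q = 0"
      "dm (0, 0, 1, 0) (xi3 V) q = 4 * dm (1, 0, 0, 0) (xi1 V) q"
      using dm_locally_constant[OF \<Omega> smi(2) _ q, of 1 0 0 0 0] xi3 a[OF q] by simp_all
    show "dm (0, 0, 1, 0) (xi1 V) q = - 2 * lam * dm (1, 0, 0, 0) (phi V) q"
      "dm (0, 0, 1, 0) (xi2 V) q = - 2 * lam * dm (0, 1, 0, 0) (phi V) q"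
      "dm (0, 0, 1, 0) (phi V) q = 0"
      using N(5-7)[OF q] a[OF q] by simp_all
  qed
qed

lemma classical_is_nonclassical:
  "classical_symmetry nu kappa lam \<Omega> V \<Longrightarrow> nonclassical_symmetry nu kappa lam \<Omega> V"
  by (simp add: classical_symmetry_def nonclassical_symmetry_def)

theorem mainTheorem7:
  fixes nu kappa lam :: real and \<Omega> :: "pt set" and V :: vfield
  assumes "kappa \<noteq> 0" and "lam \<noteq> 0"
    and "open \<Omega>"
    and "smooth_vfield \<Omega> V"
    and "\<forall>p\<in>\<Omega>. xi3 V p \<noteq> 0"
  shows "(nonclassical_symmetry nu kappa lam \<Omega> V \<longleftrightarrow>
            (\<exists>f W. smooth_on \<Omega> f \<and> (\<forall>p\<in>\<Omega>. f p \<noteq> 0) \<and>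
                   classical_symmetry nu kappa lam \<Omega> W \<and> multiple_on \<Omega> f W V))
       \<and> (nu \<noteq> 0 \<and> (\<forall>p\<in>\<Omega>. xi3 V p = 1) \<longrightarrow>
            (nonclassical_symmetry nu kappa lam \<Omega> V \<longleftrightarrow> classical_symmetry nu kappa lam \<Omega> V))"
proof (intro conjI impI iffI)
  assume V: "nonclassical_symmetry nu kappa lam \<Omega> V"
  define V' where "V' = \<lparr>xi1 = \<lambda>p. xi1 V p / xi3 V p, xi2 = \<lambda>p. xi2 V p / xi3 V p,
      xi3 = \<lambda>_. 1, phi = \<lambda>p. phi V p / xi3 V p\<rparr>"
  have sm3: "smooth_on \<Omega> (xi3 V)" using assms(4) by (simp add: smooth_vfield_def)
  have smV': "smooth_vfield \<Omega> V'"
    using assms(4,5) smooth_on_divide[OF assms(3) _ sm3]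
    by (simp add: V'_def smooth_vfield_def smooth_on_const)
  have mult: "multiple_on \<Omega> (\<lambda>p. 1 / xi3 V p) V V'"
    using assms(5) by (simp add: multiple_on_def V'_def)
  have "nonclassical_symmetry nu kappa lam \<Omega> V'"
    by (rule nonclassical_symmetry_multiple[OF assms(3) _ _ smV' mult V])
      (use smooth_on_divide[OF assms(3) smooth_on_const sm3] assms(5) in auto)
  moreover have "\<forall>p\<in>\<Omega>. xi3 V' p = 1" by (simp add: V'_def)
  ultimately obtain f W where fW: "smooth_on \<Omega> f" "\<forall>p\<in>\<Omega>. f p \<noteq> 0"
      "classical_symmetry nu kappa lam \<Omega> W" "multiple_on \<Omega> f W V'"
    using normalized_nonclassical_is_multiple_of_classical[OF assms(3) _ _ assms(1,2)] by blast
  have "multiple_on \<Omega> (\<lambda>p. xi3 V p * f p) W V"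
    using fW(4) assms(5) by (simp add: multiple_on_def V'_def field_simps)
  moreover have "smooth_on \<Omega> (\<lambda>p. xi3 V p * f p)"
    by (rule smooth_on_mult[OF assms(3) sm3 fW(1)])
  ultimately show "\<exists>f W. smooth_on \<Omega> f \<and> (\<forall>p\<in>\<Omega>. f p \<noteq> 0) \<and>
      classical_symmetry nu kappa lam \<Omega> W \<and> multiple_on \<Omega> f W V"
    using fW(2,3) assms(5) by (intro exI[of _ "\<lambda>p. xi3 V p * f p"] exI[of _ W]) auto
next
  assume "\<exists>f W. smooth_on \<Omega> f \<and> (\<forall>p\<in>\<Omega>. f p \<noteq> 0) \<and>
      classical_symmetry nu kappa lam \<Omega> W \<and> multiple_on \<Omega> f W V"
  then show "nonclassical_symmetry nu kappa lam \<Omega> V"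
    using nonclassical_symmetry_multiple[OF assms(3) _ _ assms(4)] classical_is_nonclassical by metis
next
  assume "nu \<noteq> 0 \<and> (\<forall>p\<in>\<Omega>. xi3 V p = 1)" "nonclassical_symmetry nu kappa lam \<Omega> V"
  then show "classical_symmetry nu kappa lam \<Omega> V"
    using nonclassical_is_classical[OF assms(3) _ _ assms(1,2)] by blast
next
  assume "classical_symmetry nu kappa lam \<Omega> V"
  then show "nonclassical_symmetry nu kappa lam \<Omega> V" by (rule classical_is_nonclassical)
qed

end
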